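(* Let $N\ge 1$, $0<\theta\le 2$ and $p>1$, and set $p_\theta:=1+\theta/N$. Let $A>0$ and let $\phi$ be a nonnegative $L^\infty(\mathbf{R}^N)$-function such that $\phi(x)\ge(1+|x|)^{-A}$ for almost all $x\in\mathbf{R}^N$. For $\lambda>0$ let $T(\lambda\phi)$ be the maximal existence time of the minimal solution of the Cauchy problem $\partial_t u+(-\Delta)^{\theta/2}u=u^p$, $u(0)=\lambda\phi$ (see the context). (i) Let $p=p_\theta$ and $A\ge\theta/(p-1)=N$. Then there exists a positive constant $C_1$ such that $$\log T(\lambda\phi)\le\begin{cases}C_1\lambda^{-(p-1)}&\text{if }A>N,\\ C_1\lambda^{-\frac{p-1}{p}}&\text{if }A=N,\end{cases}$$ for all small enough $\lambda>0$. (ii) Let $1<p<p_\theta$ or $A<\theta/(p-1)$. Then there exists a positive constant $C_2$ such that $$T(\lambda\phi)\le\begin{cases}C_2\lambda^{-\left(\frac{1}{p-1}-\frac1\theta\min\{A,N\}\right)^{-1}}&\text{if }A\ne N,\\ C_2\left(\dfrac{\lambda^{-1}}{\log(\lambda^{-1})}\right)^{\left(\frac{1}{p-1}-\frac N\theta\right)^{-1}}&\text{if }A=N,\end{cases}$$ for all small enough $\lambda>0$.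
   Context: A nonnegative locally integrable function $\mu$ is identified with the Radon measure $\mu\,dx$. $G=G(x,t)$ denotes the fundamental solution of $\partial_t u+(-\Delta)^{\theta/2}u=0$ in $\mathbf{R}^N\times(0,\infty)$, i.e. the positive smooth kernel with $\int_{\mathbf{R}^N}G(x,t)e^{-i\xi\cdot x}\,dx=e^{-t|\xi|^\theta}$ (the Gauss kernel $(4\pi t)^{-N/2}e^{-|x|^2/4t}$ when $\theta=2$). For a Radon measure $\mu$ in $\mathbf{R}^N$ and $0<T\le\infty$, a nonnegative measurable function $u$ in $\mathbf{R}^N\times(0,T)$ is a solution of the Cauchy problem $\partial_t u+(-\Delta)^{\theta/2}u=u^p$, $u(0)=\mu$, in $\mathbf{R}^N\times[0,T)$ if $$\infty>u(x,t)=\int_{\mathbf{R}^N}G(x-y,t)\,d\mu(y)+\int_0^t\int_{\mathbf{R}^N}G(x-y,t-s)u(y,s)^p\,dy\,ds$$ for almost all $x\in\mathbf{R}^N$ and $0<t<T$. Such a solution $u$ is minimal in $\mathbf{R}^N\times[0,T)$ if $u(x,t)\le v(x,t)$ for almost all $x\in\mathbf{R}^N$ and $0<t<T$, for any solution $v$ of the same Cauchy problem in $\mathbf{R}^N\times[0,T)$. The minimal solution is unique, and $T(\mu)$ denotes its maximal existence time, i.e. the supremum of all $T\in(0,\infty]$ such that the minimal solution exists in $\mathbf{R}^N\times[0,T)$. *)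

theory Defs
  imports "HOL-Analysis.Analysis"
begin

(* Meant for open S. *)
primrec Ck_on :: "nat \<Rightarrow> 'b::euclidean_space set \<Rightarrow> ('b \<Rightarrow> real) \<Rightarrow> bool" where
  "Ck_on 0 S f \<longleftrightarrow> continuous_on S f"
| "Ck_on (Suc k) S f \<longleftrightarrow>
     (\<forall>x\<in>S. f differentiable (at x)) \<and>
     (\<forall>v. Ck_on k S (\<lambda>x. frechet_derivative f (at x) v))"

definition smooth_on :: "'b::euclidean_space set \<Rightarrow> ('b \<Rightarrow> real) \<Rightarrow> bool" where
  "smooth_on S f \<longleftrightarrow> (\<forall>k. Ck_on k S f)"

(* Smoothness together with the Fourier transform determines G x t for all t > 0;
   the values at t \<le> 0 are irrelevant. *)
definition fundamental_solution ::
    "real \<Rightarrow> ('a::euclidean_space \<Rightarrow> real \<Rightarrow> real) \<Rightarrow> bool" where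
  "fundamental_solution \<theta> G \<longleftrightarrow>
     (\<forall>x t. 0 < t \<longrightarrow> 0 < G x t) \<and>
     smooth_on (UNIV \<times> {0<..}) (\<lambda>(x, t). G x t) \<and>
     (\<forall>t>0. \<forall>\<xi>. has_bochner_integral lborel
        (\<lambda>x. complex_of_real (G x t) * exp (- \<i> * complex_of_real (\<xi> \<bullet> x)))
        (complex_of_real (exp (- t * norm \<xi> powr \<theta>))))"

(* The Borel measure f dx, for a nonnegative Lebesgue measurable f. *)
definition function_measure :: "('a::euclidean_space \<Rightarrow> real) \<Rightarrow> 'a measure" where
  "function_measure f = distr (density lebesgue (\<lambda>x. ennreal (f x))) borel (\<lambda>x. x)"

definition slab :: "ennreal \<Rightarrow> ('a::euclidean_space \<times> real) set" where
  "slab T = {(x, t). 0 < t \<and> ennreal t < T}"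

(* T ranges over (0, \<infinity>], and u is only relevant on slab T. The requirement that u be
   finite almost everywhere is built in by taking u real-valued: the equation forces
   the right-hand side to be finite. "Almost all" refers to the Lebesgue measure on
   space-time. *)
definition cauchy_solution ::
    "('a::euclidean_space \<Rightarrow> real \<Rightarrow> real) \<Rightarrow> real \<Rightarrow> 'a measure \<Rightarrow> ennreal \<Rightarrow>
     ('a \<times> real \<Rightarrow> real) \<Rightarrow> bool" where
  "cauchy_solution G p \<mu> T u \<longleftrightarrow>
     u \<in> borel_measurable (lebesgue_on (slab T)) \<and>
     (\<forall>z\<in>slab T. 0 \<le> u z) \<and>
     (AE (x, t) in lebesgue_on (slab T).
        ennreal (u (x, t)) =
          (\<integral>\<^sup>+ y. ennreal (G (x - y) t) \<partial>\<mu>) +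
          (\<integral>\<^sup>+ s\<in>{0<..<t}.
             (\<integral>\<^sup>+ y. ennreal (G (x - y) (t - s) * u (y, s) powr p) \<partial>lebesgue) \<partial>lebesgue))"

definition minimal_solution ::
    "('a::euclidean_space \<Rightarrow> real \<Rightarrow> real) \<Rightarrow> real \<Rightarrow> 'a measure \<Rightarrow> ennreal \<Rightarrow>
     ('a \<times> real \<Rightarrow> real) \<Rightarrow> bool" where
  "minimal_solution G p \<mu> T u \<longleftrightarrow>
     cauchy_solution G p \<mu> T u \<and>
     (\<forall>v. cauchy_solution G p \<mu> T v \<longrightarrow> (AE z in lebesgue_on (slab T). u z \<le> v z))"

definition maximal_time ::
    "('a::euclidean_space \<Rightarrow> real \<Rightarrow> real) \<Rightarrow> real \<Rightarrow> 'a measure \<Rightarrow> ennreal" where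
  "maximal_time G p \<mu> = Sup {T. 0 < T \<and> (\<exists>u. minimal_solution G p \<mu> T u)}"

(* Upper bound for log T with T in [0, \<infinity>], where log \<infinity> = \<infinity> and log 0 = -\<infinity>
   (whereas ln 0 = 0 in the library). *)
definition log_le :: "ennreal \<Rightarrow> real \<Rightarrow> bool" where
  "log_le T b \<longleftrightarrow> T < \<infinity> \<and> (T = 0 \<or> ln (enn2real T) \<le> b)"

end

(* Only lower bounds on solutions are needed. By uniqueness of the Fourier transform, G is
   self-similar, so G(x,t) >= c t^(-N/theta) on parabolic balls |x| <= K t^(1/theta). Inserting this
   in the integral equation shows that a solution which is at least B R^(-theta/(p-1)) on a parabolic
   cylinder of radius R is infinite on a smaller cylinder (iterate on shrinking cylinders). Comparing
   with the linear part bounds the mass of the initial data in a ball by C T^(N/theta-1/(p-1)),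
   which is (ii). In the critical case each dyadic time interval
   [2^k, 2^(k+1)] adds a fixed multiple of m^p to the mass m present two intervals before, and m must
   stay bounded; hence the number of intervals, which is comparable to log T, is at most a multiple
   of M^(1-p), where M is the initial mass. *)

theory Submission
  imports Defs "HOL-Probability.Characteristic_Functions"
begin

text \<open>\<open>fundamental_solution\<close> describes the kernel only by positivity, smoothness
  and its Fourier transform, so every kernel estimate is the minimum of \<open>G x 1\<close> over a
  ball, rescaled. Such an estimate is good only where \<open>t - s\<close> is comparable to the
  scale of the cylinder; this forces the time windows that stay away from \<open>t\<close> and, in
  the critical case, the delay of two dyadic intervals. At the critical exponent the linear decay
  t^(-N/theta) and the blow-up threshold R^(-theta/(p-1)) with R = t^(1/theta) scale alike: the mass
  bound then no longer depends on time, and the bound on the lifespan must come from the growth of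
  the mass. The parameter lambda enters only through the mass of a ball: of radius t^(1/theta) in
  (ii), of radius 1 in (i) with A > N. For A = N that mass grows like log R, which gives the
  logarithm in (ii) and, in (i), a larger radius to be balanced against the time lost in waiting
  until the ball is filled. The equation holds only almost everywhere, so all bounds are
  almost-everywhere bounds, and blow-up contradicts that u is real-valued.\<close>

subsection \<open>Lower bound for the fundamental solution\<close>

lemma lborel_prod_Basis:
  fixes f :: "'a::euclidean_space \<Rightarrow> real \<Rightarrow> complex"
  assumes "\<And>b. b \<in> Basis \<Longrightarrow> integrable lborel (f b)"
  shows "has_bochner_integral lborel (\<lambda>x::'a. \<Prod>b\<in>Basis. f b (x \<bullet> b))
           (\<Prod>b\<in>Basis. integral\<^sup>L lborel (f b))"
proof -
  interpret product_sigma_finite "\<lambda>_::'a. lborel :: real measure" ..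
  have [measurable]: "\<And>b. b \<in> Basis \<Longrightarrow> f b \<in> borel_measurable borel"
    using assms borel_measurable_integrable by fastforce
  let ?S = "\<lambda>f::'a \<Rightarrow> real. \<Sum>b\<in>Basis. f b *\<^sub>R b"
  have eq: "(\<Prod>b\<in>Basis. f b (?S x \<bullet> b)) = (\<Prod>b\<in>Basis. f b (x b))" for x
    by (intro prod.cong) auto
  show ?thesis
    unfolding has_bochner_integral_iff
    by (subst (1 2) lborel_eq)
       (simp add: integrable_distr_eq integral_distr eq product_integrable_prod
          product_integral_prod assms)
qed

text \<open>The integral factorises over coordinates into characteristic functions of the standard
  normal distribution; its normalisation leaves no constant in the result.\<close>

lemma has_bochner_integral_gauss_cis:
  fixes z :: "'a::euclidean_space"
  shows "has_bochner_integral lborel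
    (\<lambda>\<xi>::'a. complex_of_real (\<Prod>b\<in>Basis. std_normal_density (\<xi> \<bullet> b)) * exp (\<i> * complex_of_real (\<xi> \<bullet> z)))
    (complex_of_real (exp (- (norm z)\<^sup>2 / 2)))"
proof -
  have int: "integrable lborel (\<lambda>x. complex_of_real (std_normal_density x) * iexp (t * x))" for t
    by (rule Bochner_Integration.integrable_bound[OF integrable_normal_density[of 1 0]])
       (auto simp: norm_mult)
  have val: "(LINT x|lborel. complex_of_real (std_normal_density x) * iexp (t * x)) =
      complex_of_real (exp (- t\<^sup>2 / 2))" for t
  proof -
    have "char std_normal_distribution t =
        (LINT x|lborel. complex_of_real (std_normal_density x) * iexp (t * x))"
      unfolding char_def by (subst integral_density) (auto simp: scaleR_conv_of_real)
    then show ?thesis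
      by (simp add: char_std_normal_distribution)
  qed
  have *: "has_bochner_integral lborel
      (\<lambda>\<xi>::'a. \<Prod>b\<in>Basis. complex_of_real (std_normal_density (\<xi> \<bullet> b)) * iexp ((z \<bullet> b) * (\<xi> \<bullet> b)))
      (\<Prod>b\<in>Basis. complex_of_real (exp (- (z \<bullet> b)\<^sup>2 / 2)))"
    using lborel_prod_Basis[of "\<lambda>b x. complex_of_real (std_normal_density x) * iexp ((z \<bullet> b) * x)"] int val
    by simp
  have 1: "(\<Prod>b\<in>Basis. complex_of_real (std_normal_density (\<xi> \<bullet> b)) * iexp ((z \<bullet> b) * (\<xi> \<bullet> b))) =
      complex_of_real (\<Prod>b\<in>Basis. std_normal_density (\<xi> \<bullet> b)) * exp (\<i> * complex_of_real (\<xi> \<bullet> z))" for \<xi> :: 'a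
    by (subst euclidean_inner[of \<xi> z])
       (simp add: prod.distrib exp_sum[symmetric] sum_distrib_left mult_ac)
  have "(norm z)\<^sup>2 = (\<Sum>b\<in>Basis. (z \<bullet> b)\<^sup>2)"
    by (subst power2_norm_eq_inner, subst euclidean_inner) (simp add: power2_eq_square)
  then have 2: "(\<Prod>b\<in>Basis. complex_of_real (exp (- (z \<bullet> b)\<^sup>2 / 2))) = complex_of_real (exp (- (norm z)\<^sup>2 / 2))"
    by (simp add: exp_sum[symmetric] of_real_prod[symmetric] sum_negf sum_divide_distrib del: of_real_prod)
  show ?thesis using *[unfolded 1 2] .
qed

text \<open>The Gaussian is itself a Fourier transform, so by Fubini its pairing with \<open>d\<close> is an integral of
  the transform of \<open>d\<close>.\<close>
lemma gauss_test_eq_0: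
  fixes d :: "'a::euclidean_space \<Rightarrow> real"
  assumes int: "integrable lborel d"
    and ft: "\<And>\<xi>. (LINT x|lborel. complex_of_real (d x) * exp (- \<i> * complex_of_real (\<xi> \<bullet> x))) = 0"
  shows "(LINT y|lborel. d y * exp (- (s * norm (x - y))\<^sup>2 / 2)) = 0"
proof -
  define g where "g \<xi> = (\<Prod>b\<in>Basis. std_normal_density (\<xi> \<bullet> b))" for \<xi> :: 'a
  have g: "has_bochner_integral lborel
    (\<lambda>\<xi>::'a. complex_of_real (g \<xi>) * exp (\<i> * complex_of_real (\<xi> \<bullet> z)))
    (complex_of_real (exp (- (norm z)\<^sup>2 / 2)))" for z
    unfolding g_def by (rule has_bochner_integral_gauss_cis)
  have g0: "g \<xi> \<ge> 0" for \<xi> unfolding g_def by (intro prod_nonneg) auto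
  have [measurable]: "g \<in> borel_measurable borel" unfolding g_def by measurable
  have [measurable]: "d \<in> borel_measurable borel" using int by auto
  have "complex_of_real (g \<xi>) * exp (\<i> * complex_of_real (\<xi> \<bullet> 0)) = complex_of_real (g \<xi>)" for \<xi> by simp
  then have "integrable lborel (\<lambda>\<xi>. complex_of_real (g \<xi>))"
    using g[of 0] unfolding has_bochner_integral_iff by simp
  then have gint: "integrable lborel g"
    using integrable_Re by fastforce
  define F where "F y \<xi> = complex_of_real (d y) *
      (complex_of_real (g \<xi>) * exp (\<i> * complex_of_real (\<xi> \<bullet> (s *\<^sub>R (x - y)))))" for y \<xi>
  have nF: "norm (F y \<xi>) = \<bar>d y\<bar> * g \<xi>" for y \<xi>
    by (simp add: F_def norm_mult g0)
  have "complex_of_real (LINT y|lborel. d y * exp (- (s * norm (x - y))\<^sup>2 / 2)) =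
        (LINT y|lborel. complex_of_real (d y) * complex_of_real (exp (- (norm (s *\<^sub>R (x - y)))\<^sup>2 / 2)))"
    unfolding of_real_mult[symmetric] integral_complex_of_real by (simp add: power_mult_distrib)
  also have "\<dots> = (LINT y|lborel. LINT \<xi>|lborel. F y \<xi>)"
    unfolding F_def
    using g[THEN has_bochner_integral_integral_eq] by (simp only: integral_mult_right_zero)
  also have "\<dots> = (LINT \<xi>|lborel. LINT y|lborel. F y \<xi>)"
  proof (rule lborel_pair.Fubini_integral[symmetric], rule lborel_pair.Fubini_integrable)
    show "(\<lambda>(x, y). F x y) \<in> borel_measurable (lborel \<Otimes>\<^sub>M lborel)"
      unfolding F_def by measurable
    show "integrable lborel (\<lambda>x. LINT y|lborel. norm (case (x, y) of (x, y) \<Rightarrow> F x y))"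
      using int by (simp add: nF)
    show "AE x in lborel. integrable lborel (\<lambda>y. case (x, y) of (x, y) \<Rightarrow> F x y)"
      unfolding F_def prod.case
      by (intro AE_I2 integrable_mult_right has_bochner_integral_iff[THEN iffD1, OF g, THEN conjunct1])
  qed
  also have "\<dots> = 0"
  proof -
    have "(LINT y|lborel. F y \<xi>) = 0" for \<xi>
    proof -
      have "F y \<xi> = complex_of_real (g \<xi>) * exp (\<i> * complex_of_real (s * (\<xi> \<bullet> x))) *
          (complex_of_real (d y) * exp (- \<i> * complex_of_real ((s *\<^sub>R \<xi>) \<bullet> y)))" for y
        unfolding F_def by (simp add: inner_diff_right algebra_simps flip: exp_add)
      then show ?thesis using ft[of "s *\<^sub>R \<xi>"] by simp
    qed
    then show ?thesis by simp
  qed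
  finally show ?thesis by simp
qed

text \<open>If \<open>d x > 0\<close>, narrow Gaussians around \<open>x\<close> detect it: the part
  of the pairing near \<open>x\<close> is positive and decays more slowly in \<open>s\<close> than
  the part far from \<open>x\<close>, although the pairing is 0 for every \<open>s\<close>. The
  statement is one-sided because equality of two functions follows by exchanging them.\<close>

lemma fourier_zero_imp_nonpos:
  fixes d :: "'a::euclidean_space \<Rightarrow> real"
  assumes cont: "continuous_on UNIV d" and int: "integrable lborel d"
    and ft: "\<And>\<xi>. (LINT x|lborel. complex_of_real (d x) * exp (- \<i> * complex_of_real (\<xi> \<bullet> x))) = 0"
  shows "d x \<le> 0"
proof (rule ccontr)
  assume "\<not> d x \<le> 0"
  define \<eta> where "\<eta> = d x / 2"
  have \<eta>: "\<eta> > 0" using \<open>\<not> d x \<le> 0\<close> by (simp add: \<eta>_def)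
  have [measurable]: "d \<in> borel_measurable borel" using int by auto
  obtain r where r: "r > 0" "\<And>y. dist y x < r \<Longrightarrow> dist (d y) (d x) < \<eta>"
    using cont \<eta> unfolding continuous_on_iff by (metis UNIV_I)
  define \<delta> where "\<delta> = r / 2"
  have \<delta>: "\<delta> > 0" "\<And>y. norm (x - y) \<le> \<delta> \<Longrightarrow> d y \<ge> \<eta>"
  proof -
    show "\<delta> > 0" using r by (simp add: \<delta>_def)
    fix y assume "norm (x - y) \<le> \<delta>"
    then have "dist y x < r" using r(1) by (simp add: \<delta>_def dist_norm norm_minus_commute)
    then have "\<bar>d y - d x\<bar> < \<eta>" using r(2) by (simp add: dist_real_def)
    then show "d y \<ge> \<eta>" unfolding \<eta>_def by linarith
  qed
  have fin: "emeasure lborel (cball x (\<delta> / 2)) < top"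
    using emeasure_bounded_finite[OF bounded_cball, of x "\<delta> / 2"] by simp
  define V where "V = measure lborel (cball x (\<delta> / 2))"
  have V: "V > 0" unfolding V_def using \<delta> by (simp add: content_cball)
  define I where "I = (LINT y|lborel. \<bar>d y\<bar>)"
  have bnd: "\<eta> * V * exp (- (s * (\<delta> / 2))\<^sup>2 / 2) \<le> I * exp (- (s * \<delta>)\<^sup>2 / 2)" if "s \<ge> 0" for s
  proof -
    \<comment> \<open>Three zones: on the ball of radius \<open>\<delta> / 2\<close> both factors
      are bounded below, in the shell up to \<open>\<delta>\<close> the integrand is nonnegative,
      and beyond it the absolute value is paid for with the small weight at distance
      \<open>\<delta>\<close>.\<close>
    have ptw: "\<eta> * exp (- (s * (\<delta> / 2))\<^sup>2 / 2) * indicator (cball x (\<delta> / 2)) y - \<bar>d y\<bar> * exp (- (s * \<delta>)\<^sup>2 / 2)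
        \<le> d y * exp (- (s * norm (x - y))\<^sup>2 / 2)" for y
    proof -
      consider "norm (x - y) \<le> \<delta> / 2" | "\<delta> / 2 < norm (x - y)" "norm (x - y) \<le> \<delta>" | "\<delta> < norm (x - y)"
        by linarith
      then show ?thesis
      proof cases
        case 1
        then have "d y \<ge> \<eta>" using \<delta> by auto
        moreover have "(s * norm (x - y))\<^sup>2 \<le> (s * (\<delta> / 2))\<^sup>2"
          using 1 that by (intro power_mono mult_left_mono) auto
        ultimately have "\<eta> * exp (- (s * (\<delta> / 2))\<^sup>2 / 2) \<le> d y * exp (- (s * norm (x - y))\<^sup>2 / 2)"
          using \<eta> by (intro mult_mono) auto
        moreover have "\<bar>d y\<bar> * exp (- (s * \<delta>)\<^sup>2 / 2) \<ge> 0" by simp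
        moreover have "indicator (cball x (\<delta> / 2)) y = (1::real)" using 1 by (simp add: dist_norm)
        ultimately show ?thesis by (simp only: mult_1_right)
      next
        case 2
        then have "d y * exp (- (s * norm (x - y))\<^sup>2 / 2) \<ge> 0"
          using \<delta>(2)[of y] \<eta> by (intro mult_nonneg_nonneg) auto
        moreover have "\<bar>d y\<bar> * exp (- (s * \<delta>)\<^sup>2 / 2) \<ge> 0" by simp
        moreover have "indicator (cball x (\<delta> / 2)) y = (0::real)" using 2 by (simp add: dist_norm)
        ultimately show ?thesis by (simp only: mult_zero_right)
      next
        case 3
        then have "(s * norm (x - y))\<^sup>2 \<ge> (s * \<delta>)\<^sup>2"
          using that \<delta> by (intro power_mono mult_left_mono) auto
        then have "\<bar>d y\<bar> * exp (- (s * norm (x - y))\<^sup>2 / 2) \<le> \<bar>d y\<bar> * exp (- (s * \<delta>)\<^sup>2 / 2)"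
          by (intro mult_left_mono) auto
        moreover have "- (\<bar>d y\<bar> * exp (- (s * norm (x - y))\<^sup>2 / 2)) \<le> d y * exp (- (s * norm (x - y))\<^sup>2 / 2)"
          using mult_right_mono[of "- \<bar>d y\<bar>" "d y" "exp (- (s * norm (x - y))\<^sup>2 / 2)"] by simp
        moreover have "\<not> norm (x - y) \<le> \<delta> / 2" using 3 \<delta> by auto
        ultimately show ?thesis using 3 \<delta> by (simp add: dist_norm indicator_def)
      qed
    qed
    have "(LINT y|lborel. \<eta> * exp (- (s * (\<delta> / 2))\<^sup>2 / 2) * indicator (cball x (\<delta> / 2)) y - \<bar>d y\<bar> * exp (- (s * \<delta>)\<^sup>2 / 2))
        \<le> (LINT y|lborel. d y * exp (- (s * norm (x - y))\<^sup>2 / 2))"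
    proof (rule integral_mono)
      show "integrable lborel (\<lambda>y. d y * exp (- (s * norm (x - y))\<^sup>2 / 2))"
        by (rule Bochner_Integration.integrable_bound[OF int]) (auto simp: abs_mult intro!: mult_left_le)
      show "integrable lborel (\<lambda>y. \<eta> * exp (- (s * (\<delta> / 2))\<^sup>2 / 2) * indicator (cball x (\<delta> / 2)) y - \<bar>d y\<bar> * exp (- (s * \<delta>)\<^sup>2 / 2))"
        using int by (auto intro!: Bochner_Integration.integrable_diff integrable_mult_right integrable_real_indicator
             simp: fin)
    qed (use ptw in auto)
    also have "\<dots> = 0" by (rule gauss_test_eq_0[OF int ft])
    also have "(LINT y|lborel. \<eta> * exp (- (s * (\<delta> / 2))\<^sup>2 / 2) * indicator (cball x (\<delta> / 2)) y - \<bar>d y\<bar> * exp (- (s * \<delta>)\<^sup>2 / 2))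
      = \<eta> * exp (- (s * (\<delta> / 2))\<^sup>2 / 2) * V - I * exp (- (s * \<delta>)\<^sup>2 / 2)"
      unfolding V_def I_def using int
      by (subst Bochner_Integration.integral_diff)
         (auto intro!: integrable_mult_right integrable_real_indicator simp: fin)
    finally show ?thesis by (simp add: mult_ac)
  qed
  have "eventually (\<lambda>s. \<eta> * V * exp (- (s * (\<delta> / 2))\<^sup>2 / 2) > I * exp (- (s * \<delta>)\<^sup>2 / 2)) at_top"
  proof -
    define c where "c = \<eta> * V"
    have c: "c > 0" using \<eta> V by (simp add: c_def)
    \<comment> \<open>The quotient of the two Gaussian weights has the exponent 1/2 - 1/8 =
      3/8.\<close>
    have lim: "((\<lambda>s. I * exp (- (3 * \<delta>\<^sup>2 / 8) * s\<^sup>2)) \<longlongrightarrow> 0) at_top"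
    proof -
      have "filterlim (\<lambda>s. (3 * \<delta>\<^sup>2 / 8) * s\<^sup>2) at_top at_top"
        using \<delta> by (intro filterlim_tendsto_pos_mult_at_top[OF tendsto_const] filterlim_pow_at_top filterlim_ident) auto
      then have "((\<lambda>s. exp (- ((3 * \<delta>\<^sup>2 / 8) * s\<^sup>2))) \<longlongrightarrow> 0) at_top"
        by (intro filterlim_compose[OF exp_at_bot] filterlim_compose[OF filterlim_uminus_at_bot_at_top])
      then show ?thesis by (auto intro!: tendsto_mult_right_zero)
    qed
    have "eventually (\<lambda>s. I * exp (- (3 * \<delta>\<^sup>2 / 8) * s\<^sup>2) < c) at_top"
      using lim c by (rule order_tendstoD(2))
    then show ?thesis
    proof (rule eventually_mono)
      fix s assume a: "I * exp (- (3 * \<delta>\<^sup>2 / 8) * s\<^sup>2) < c"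
      have e: "exp (- (s * \<delta>)\<^sup>2 / 2) = exp (- (3 * \<delta>\<^sup>2 / 8) * s\<^sup>2) * exp (- (s * (\<delta> / 2))\<^sup>2 / 2)"
        unfolding exp_add[symmetric] by (simp add: power_mult_distrib power_divide field_simps)
      have "I * exp (- (s * \<delta>)\<^sup>2 / 2) = (I * exp (- (3 * \<delta>\<^sup>2 / 8) * s\<^sup>2)) * exp (- (s * (\<delta> / 2))\<^sup>2 / 2)"
        unfolding e by simp
      also have "\<dots> < c * exp (- (s * (\<delta> / 2))\<^sup>2 / 2)"
        using a by (intro mult_strict_right_mono) auto
      finally show "\<eta> * V * exp (- (s * (\<delta> / 2))\<^sup>2 / 2) > I * exp (- (s * \<delta>)\<^sup>2 / 2)"
        by (simp add: c_def)
    qed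
  qed
  then have "eventually (\<lambda>s::real. False) at_top"
    using eventually_ge_at_top[of 0] by eventually_elim (use bnd in force)
  then show False by simp
qed

lemma fourier_mono:
  fixes f g :: "'a::euclidean_space \<Rightarrow> real"
  assumes "continuous_on UNIV f" "continuous_on UNIV g" "integrable lborel f" "integrable lborel g"
    and f: "\<And>\<xi>. has_bochner_integral lborel
      (\<lambda>x. complex_of_real (f x) * exp (- \<i> * complex_of_real (\<xi> \<bullet> x))) (F \<xi>)"
    and g: "\<And>\<xi>. has_bochner_integral lborel
      (\<lambda>x. complex_of_real (g x) * exp (- \<i> * complex_of_real (\<xi> \<bullet> x))) (F \<xi>)"
  shows "f x \<le> g x"
proof -
  have "(LINT x|lborel. complex_of_real (f x - g x) * exp (- \<i> * complex_of_real (\<xi> \<bullet> x))) = 0" for \<xi>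
    using has_bochner_integral_diff[OF f[of \<xi>] g[of \<xi>]]
    by (simp only: of_real_diff left_diff_distrib has_bochner_integral_iff diff_self)
  then have "f x - g x \<le> 0"
    using assms(1-4) by (intro fourier_zero_imp_nonpos continuous_on_diff Bochner_Integration.integrable_diff)
  then show ?thesis by simp
qed

section \<open>Self-similarity of the kernel and its consequence on parabolic balls\<close>

lemma has_bochner_integral_lborel_scale:
  fixes f :: "'a::euclidean_space \<Rightarrow> complex"
  assumes "has_bochner_integral lborel f I" and "c > 0"
  shows "has_bochner_integral lborel (\<lambda>x. complex_of_real (c ^ DIM('a)) * f (c *\<^sub>R x)) I"
proof -
  have [measurable]: "f \<in> borel_measurable borel"
    using assms(1) by (auto dest: has_bochner_integral_integrable simp: has_bochner_integral_iff)
  have L: "lborel = density (distr lborel borel (\<lambda>x::'a. c *\<^sub>R x)) (\<lambda>_. ennreal (c ^ DIM('a)))"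
    using lborel_affine[of c "0::'a"] assms(2) by simp
  have "has_bochner_integral (density (distr lborel borel (\<lambda>x::'a. c *\<^sub>R x)) (\<lambda>_. ennreal (c ^ DIM('a)))) f I"
    using assms(1) by (simp flip: L)
  then have "has_bochner_integral (distr lborel borel (\<lambda>x::'a. c *\<^sub>R x)) (\<lambda>x. c ^ DIM('a) *\<^sub>R f x) I"
    unfolding has_bochner_integral_iff using assms(2)
    by (simp add: integrable_density integral_density)
  then show ?thesis
    unfolding has_bochner_integral_iff
    by (simp add: integrable_distr_eq integral_distr scaleR_conv_of_real)
qed

lemma fundamental_solution_continuous:
  fixes G :: "'a::euclidean_space \<Rightarrow> real \<Rightarrow> real"
  assumes "fundamental_solution \<theta> G" "t > 0"
  shows "continuous_on S (\<lambda>x. G x t)"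
proof -
  have "Ck_on 0 (UNIV \<times> {0<..}) (\<lambda>(x, t). G x t)"
    using assms unfolding fundamental_solution_def smooth_on_def by blast
  then have "continuous_on (UNIV \<times> {0<..}) (\<lambda>(x, t). G x t)" by simp
  then have "continuous_on S (\<lambda>x. (\<lambda>(x, t). G x t) (x, t))"
    by (rule continuous_on_compose2) (use assms(2) in \<open>auto intro!: continuous_intros\<close>)
  then show ?thesis by simp
qed

text \<open>Stretching space by \<open>c = t powr (1 / \<theta>)\<close> replaces the frequency
  \<xi> by \<xi>/c in the transform, and t |\<xi>/c|^\<theta> = |\<xi>|^\<theta>. Hence both sides
  have the same transform.\<close>

lemma fundamental_solution_scaling:
  fixes G :: "'a::euclidean_space \<Rightarrow> real \<Rightarrow> real"
  assumes G: "fundamental_solution \<theta> G" and "\<theta> > 0" "t > 0"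
  shows "t powr (real DIM('a) / \<theta>) * G (t powr (1 / \<theta>) *\<^sub>R x) t = G x 1"
proof -
  define c where "c = t powr (1 / \<theta>)"
  have c: "c > 0" "c ^ DIM('a) = t powr (real DIM('a) / \<theta>)" "c powr \<theta> = t"
    using assms by (auto simp: c_def powr_powr powr_realpow[symmetric])
  have FT: "has_bochner_integral lborel
        (\<lambda>x. complex_of_real (G x t) * exp (- \<i> * complex_of_real (\<xi> \<bullet> x)))
        (complex_of_real (exp (- t * norm \<xi> powr \<theta>)))" if "t > 0" for t \<xi>
    using G that unfolding fundamental_solution_def by blast
  have cont1: "continuous_on UNIV (\<lambda>x. c ^ DIM('a) * G (c *\<^sub>R x) t)"
    by (intro continuous_intros continuous_on_compose2[OF fundamental_solution_continuous[OF G \<open>t > 0\<close>, of UNIV]]) auto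
  have cont2: "continuous_on UNIV (\<lambda>x. G x 1)"
    by (rule fundamental_solution_continuous[OF G]) simp
  have FT1: "has_bochner_integral lborel
        (\<lambda>x. complex_of_real (c ^ DIM('a) * G (c *\<^sub>R x) t) * exp (- \<i> * complex_of_real (\<xi> \<bullet> x)))
        (complex_of_real (exp (- (norm \<xi> powr \<theta>))))" for \<xi>
  proof -
    have "t * norm (\<xi> /\<^sub>R c) powr \<theta> = norm \<xi> powr \<theta>"
      using c using \<open>t > 0\<close> by (simp add: powr_divide divide_inverse[symmetric] mult.commute[of "inverse c"])
    moreover have "(\<xi> /\<^sub>R c) \<bullet> (c *\<^sub>R x) = \<xi> \<bullet> x" for x
      using c(1) by simp
    ultimately show ?thesis
      using has_bochner_integral_lborel_scale[OF FT[OF \<open>t > 0\<close>, of "\<xi> /\<^sub>R c"] c(1)]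
      by (simp only: mult_minus_left of_real_mult mult.assoc)
  qed
  have FT2: "has_bochner_integral lborel
        (\<lambda>x. complex_of_real (G x 1) * exp (- \<i> * complex_of_real (\<xi> \<bullet> x)))
        (complex_of_real (exp (- (norm \<xi> powr \<theta>))))" for \<xi>
    using FT[of 1] by simp
  \<comment> \<open>Integrability is the existence of the transform at frequency 0.\<close>
  let ?f = "\<lambda>x. c ^ DIM('a) * G (c *\<^sub>R x) t" and ?g = "\<lambda>x. G x 1"
  have int: "integrable lborel ?f" "integrable lborel ?g"
  proof -
    have "integrable lborel (\<lambda>x. complex_of_real (?f x))" "integrable lborel (\<lambda>x. complex_of_real (?g x))"
      using FT1[of 0] FT2[of 0] by (simp_all add: has_bochner_integral_iff)
    then show "integrable lborel ?f" "integrable lborel ?g"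
      using integrable_Re by fastforce+
  qed
  have "?f x \<le> ?g x" by (rule fourier_mono[OF cont1 cont2 int FT1 FT2])
  moreover have "?g x \<le> ?f x" by (rule fourier_mono[OF cont2 cont1 int(2,1) FT2 FT1])
  ultimately show ?thesis using c by (simp add: c_def)
qed

text \<open>Scaling reduces the claim to \<open>t = 1\<close>, where a positive continuous function
  has a positive minimum on a compact ball. The constant depends on \<open>K\<close>.\<close>

lemma fundamental_solution_lower_bound:
  fixes G :: "'a::euclidean_space \<Rightarrow> real \<Rightarrow> real"
  assumes G: "fundamental_solution \<theta> G" and \<theta>: "\<theta> > 0"
  obtains c where "c > 0"
    "\<And>x t. \<lbrakk>t > 0; norm x \<le> K * t powr (1 / \<theta>)\<rbrakk> \<Longrightarrow> c * t powr (- real DIM('a) / \<theta>) \<le> G x t"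
proof -
  \<comment> \<open>The absolute value keeps the ball nonempty for negative \<open>K\<close>, so
    that the minimum exists.\<close>
  have cont: "continuous_on (cball 0 \<bar>K\<bar>) (\<lambda>x. G x 1)"
    by (rule fundamental_solution_continuous[OF G]) simp
  obtain x0 where x0: "\<And>y. y \<in> cball 0 \<bar>K\<bar> \<Longrightarrow> G x0 1 \<le> G y 1"
    using continuous_attains_inf[OF _ _ cont] by (metis cball_eq_empty compact_cball abs_ge_zero not_less)
  show thesis
  proof
    show "G x0 1 > 0" using G by (simp add: fundamental_solution_def)
    fix x :: 'a and t :: real
    assume t: "t > 0" and x: "norm x \<le> K * t powr (1 / \<theta>)"
    define y where "y = x /\<^sub>R t powr (1 / \<theta>)"
    have "norm y \<le> K" using x t by (simp add: y_def field_simps)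
    then have "G x0 1 \<le> G y 1" by (intro x0) auto
    also have "\<dots> = t powr (real DIM('a) / \<theta>) * G x t"
      using fundamental_solution_scaling[OF G \<theta> t, of y] t by (simp add: y_def)
    finally show "G x0 1 * t powr (- real DIM('a) / \<theta>) \<le> G x t"
      using t by (simp add: powr_minus field_simps)
  qed
qed

subsection \<open>Lower bounds on space-time cylinders\<close>

text \<open>A bound almost everywhere in space-time, since the integral equation gives no more than
  that. With open time intervals, the cylinders over consecutive dyadic intervals are
  disjoint.\<close>

definition above :: "('a::euclidean_space \<times> real \<Rightarrow> real) \<Rightarrow> real \<Rightarrow> real \<Rightarrow> real \<Rightarrow> real \<Rightarrow> bool" where
  "above u a \<rho> s\<^sub>1 s\<^sub>2 \<longleftrightarrow>
     (AE z in lborel. norm (fst z) \<le> \<rho> \<and> s\<^sub>1 < snd z \<and> snd z < s\<^sub>2 \<longrightarrow> a \<le> u z)"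

lemma above_mono:
  "above u a \<rho> s\<^sub>1 s\<^sub>2 \<Longrightarrow> a' \<le> a \<Longrightarrow> \<rho>' \<le> \<rho> \<Longrightarrow> s\<^sub>1 \<le> s\<^sub>1' \<Longrightarrow> s\<^sub>2' \<le> s\<^sub>2 \<Longrightarrow> above u a' \<rho>' s\<^sub>1' s\<^sub>2'"
  unfolding above_def by (erule eventually_mono) auto

text \<open>Fubini for null sets. The factors are swapped first because the Duhamel integral has
  time as its outer variable.\<close>

lemma above_slices:
  fixes u :: "'a::euclidean_space \<times> real \<Rightarrow> real"
  assumes "above u a \<rho> s\<^sub>1 s\<^sub>2"
  shows "AE s in lborel. s\<^sub>1 < s \<and> s < s\<^sub>2 \<longrightarrow> (AE y in lborel. norm y \<le> \<rho> \<longrightarrow> a \<le> u (y, s))"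
proof -
  let ?Q = "\<lambda>z. norm (fst z) \<le> \<rho> \<and> s\<^sub>1 < snd z \<and> snd z < s\<^sub>2 \<longrightarrow> a \<le> u z"
  have "AE z in (lborel :: 'a measure) \<Otimes>\<^sub>M (lborel :: real measure). ?Q z"
    using assms unfolding above_def lborel_prod .
  then have "AE z in distr ((lborel :: real measure) \<Otimes>\<^sub>M (lborel :: 'a measure))
      ((lborel :: 'a measure) \<Otimes>\<^sub>M (lborel :: real measure)) (\<lambda>(x, y). (y, x)). ?Q z"
    by (subst (asm) lborel_pair.distr_pair_swap)
  then have "AE z in (lborel :: real measure) \<Otimes>\<^sub>M (lborel :: 'a measure). ?Q (case z of (x, y) \<Rightarrow> (y, x))"
    by (rule AE_distrD[rotated]) (rule measurable_pair_swap')
  then have "AE s in lborel. AE y in lborel. ?Q (y, s)"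
    by (auto dest: lborel_pair.AE_pair)
  then show ?thesis
    by (rule eventually_mono) (auto elim: eventually_mono)
qed

text \<open>This is where finiteness of solutions enters: countably many almost-everywhere bounds
  hold simultaneously outside a null set, and a real value cannot exceed all of them, so a cylinder
  of positive volume would be null.\<close>

lemma not_above_unbounded:
  fixes u :: "'a::euclidean_space \<times> real \<Rightarrow> real"
  assumes "\<rho> > 0" "s\<^sub>1 < s\<^sub>2" and lim: "filterlim a at_top sequentially"
    and ab: "\<And>k. above u (a k) \<rho> s\<^sub>1 s\<^sub>2"
  shows False
proof -
  have "AE z in lborel. \<forall>k. norm (fst z) \<le> \<rho> \<and> s\<^sub>1 < snd z \<and> snd z < s\<^sub>2 \<longrightarrow> a k \<le> u z"
    using ab unfolding above_def by (subst AE_all_countable) auto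
  then have "AE z :: 'a \<times> real in lborel. \<not> (norm (fst z) \<le> \<rho> \<and> s\<^sub>1 < snd z \<and> snd z < s\<^sub>2)"
  proof (rule eventually_mono)
    fix z assume a: "\<forall>k. norm (fst z) \<le> \<rho> \<and> s\<^sub>1 < snd z \<and> snd z < s\<^sub>2 \<longrightarrow> a k \<le> u z"
    have "\<exists>k. a k > u z"
      using lim by (auto simp: filterlim_at_top_dense dest!: spec[of _ "u z"] eventually_happens)
    then show "\<not> (norm (fst z) \<le> \<rho> \<and> s\<^sub>1 < snd z \<and> snd z < s\<^sub>2)"
      using a by (auto simp: not_le[symmetric])
  qed
  then have "AE z in lborel. z \<notin> ball (0::'a) \<rho> \<times> {s\<^sub>1<..<s\<^sub>2}"
    by (rule eventually_mono) auto
  then have "emeasure lborel (ball (0::'a) \<rho> \<times> {s\<^sub>1<..<s\<^sub>2}) = 0"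
    by (subst (asm) AE_iff_null_sets[symmetric])
       (auto intro!: borel_open open_Times simp: null_sets_def)
  moreover have "emeasure lborel (ball (0::'a) \<rho> \<times> {s\<^sub>1<..<s\<^sub>2}) =
      emeasure lborel (ball (0::'a) \<rho>) * emeasure lborel {s\<^sub>1<..<s\<^sub>2}"
    unfolding lborel_prod[symmetric] by (rule lborel.emeasure_pair_measure_Times) auto
  moreover have "unit_ball_vol (real DIM('a)) * \<rho> ^ DIM('a) * (s\<^sub>2 - s\<^sub>1) > 0"
    using assms(1,2) by (intro mult_pos_pos) auto
  ultimately show False
    using assms(1,2) unit_ball_vol_pos[of "real DIM('a)"]
    by (auto simp: emeasure_ball ennreal_mult[symmetric] ennreal_eq_0_iff not_le)
qed

text \<open>While \<open>m\<close> stays below \<open>C\<close>, consecutive terms are comparable, so the delay only costs a constant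
  factor and \<open>m k powr (1 - p)\<close> drops by at least \<open>\<delta>\<close> in each step.\<close>
lemma delayed_recursion_bound:
  fixes m :: "nat \<Rightarrow> real"
  assumes p: "p > 1" and c: "c > 0" and M: "M > 0" and C: "C > 0"
    and m: "m 0 = M" "m (Suc 0) = M" "\<And>k. m (Suc (Suc k)) = m (Suc k) + c * m k powr p"
    and bd: "\<And>j. j \<le> n \<Longrightarrow> m j \<le> C"
  defines "\<delta> \<equiv> (p - 1) * c * (1 + c * C powr (p - 1)) powr (- 2 * p)"
  shows "real n * \<delta> \<le> M powr (1 - p) + \<delta>"
proof -
  \<comment> \<open>\<open>\<kappa>\<close> bounds the quotient of consecutive terms while they stay
    below \<open>C\<close>. Two such steps lead from \<open>m j\<close> to \<open>z\<close> below,
    whence the exponent \<open>- 2 * p\<close> in \<open>\<delta>\<close>.\<close>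
  define \<kappa> where "\<kappa> = 1 + c * C powr (p - 1)"
  have \<kappa>: "\<kappa> \<ge> 1" using c by (simp add: \<kappa>_def)
  have \<delta>: "\<delta> > 0" using p c \<kappa> by (simp add: \<delta>_def \<kappa>_def[symmetric])
  have pos: "m k > 0 \<and> m (Suc k) \<ge> m k" for k
    by (induction k) (use m M c in \<open>auto intro: add_pos_nonneg\<close>)
  have grow: "m (Suc k) \<le> \<kappa> * m k" if "m k \<le> C" for k
  proof (cases k)
    case 0
    then show ?thesis using m M \<kappa> by simp
  next
    case (Suc j)
    have "m j powr p \<le> m k powr p" using pos[of j] p Suc by (intro powr_mono2) auto
    also have "\<dots> = m k powr (p - 1) * m k"
      using pos[of k] powr_add[of "m k" "p - 1" 1] by simp
    also have "\<dots> \<le> C powr (p - 1) * m k"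
      using that pos[of k] p by (intro mult_right_mono powr_mono2) auto
    finally have "c * m j powr p \<le> c * (C powr (p - 1) * m k)" using c by simp
    then show ?thesis using m(3)[of j] Suc by (simp add: \<kappa>_def algebra_simps)
  qed
  \<comment> \<open>The extra \<open>\<delta>\<close> on the right pays for the first step, in which
    the sequence does not grow.\<close>
  have "m k powr (1 - p) + real k * \<delta> \<le> M powr (1 - p) + \<delta>" if "k \<le> n" for k
    using that
  proof (induction k)
    case 0
    then show ?case using m \<delta> by simp
  next
    case (Suc k)
    show ?case
    proof (cases k)
      case 0
      then show ?thesis using m \<delta> by simp
    next
      case (Suc j)
      define x z where "x = m k" and "z = m (Suc k)"
      have x: "x > 0" "z > 0" "x \<le> z" "z \<le> \<kappa> * x" "x \<le> \<kappa> * m j"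
        using pos[of k] grow[of k] grow[of j] bd Suc.prems Suc by (auto simp: x_def z_def)
      have zx: "z = x + c * m j powr p" using m(3)[of j] Suc by (simp add: x_def z_def)
      \<comment> \<open>The tangent at 1 of the convex function r^(1-p). This is the discrete form
        of differentiating m^(1-p) along the equation m' = c m^p.\<close>
      have "(x / z) powr (1 - p) \<ge> 1 + (p - 1) * (1 - x / z)"
      proof -
        have "(x / z) powr (1 - p) = exp ((p - 1) * (- ln (x / z)))"
          using x by (simp add: powr_def algebra_simps)
        moreover have "- ln (x / z) \<ge> 1 - x / z" using ln_le_minus_one[of "x / z"] x by simp
        then have "(p - 1) * (- ln (x / z)) \<ge> (p - 1) * (1 - x / z)"
          using p by (intro mult_left_mono) auto
        ultimately show ?thesis
          using exp_ge_add_one_self[of "(p - 1) * (- ln (x / z))"] by linarith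
      qed
      then have "(x / z) powr (1 - p) * z powr (1 - p) \<ge> (1 + (p - 1) * (1 - x / z)) * z powr (1 - p)"
        by (intro mult_right_mono) auto
      moreover have "(x / z) powr (1 - p) * z powr (1 - p) = x powr (1 - p)"
        using x by (simp add: powr_divide)
      moreover have "(1 + (p - 1) * (1 - x / z)) * z powr (1 - p)
          = z powr (1 - p) + (p - 1) * (c * m j powr p) * z powr (- p)"
      proof -
        have "(1 - x / z) * z powr (1 - p) = (z - x) * z powr (- p)"
          using x powr_add[of z 1 "- p"] by (simp add: field_simps)
        then have "(p - 1) * ((1 - x / z) * z powr (1 - p)) = (p - 1) * ((z - x) * z powr (- p))" by simp
        then show ?thesis by (simp add: zx algebra_simps)
      qed
      moreover have "(p - 1) * (c * m j powr p) * z powr (- p) \<ge> \<delta>"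
      proof -
        have "z \<le> \<kappa>\<^sup>2 * m j"
          using order_trans[OF x(4) mult_left_mono[OF x(5), of \<kappa>]] \<kappa> by (simp add: power2_eq_square mult.assoc)
        then have "z powr (- p) \<ge> (\<kappa>\<^sup>2 * m j) powr (- p)" using x p by (intro powr_mono2') auto
        also have "(\<kappa>\<^sup>2 * m j) powr (- p) = \<kappa> powr (- 2 * p) * m j powr (- p)"
          using \<kappa> pos[of j] by (simp add: powr_mult powr_powr powr_numeral[symmetric] del: powr_numeral)
        finally have "m j powr p * (\<kappa> powr (- 2 * p) * m j powr (- p)) \<le> m j powr p * z powr (- p)"
          by (intro mult_left_mono) auto
        moreover have "m j powr p * m j powr (- p) = 1" using pos[of j] by (simp flip: powr_add)
        ultimately have "\<kappa> powr (- 2 * p) \<le> m j powr p * z powr (- p)"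
          by (metis mult.left_commute mult.right_neutral)
        then have "(p - 1) * c * \<kappa> powr (- 2 * p) \<le> (p - 1) * c * (m j powr p * z powr (- p))"
          using p c by (intro mult_left_mono) auto
        then show ?thesis by (simp add: \<delta>_def \<kappa>_def[symmetric] mult_ac)
      qed
      ultimately have "z powr (1 - p) + \<delta> \<le> x powr (1 - p)" by linarith
      then show ?thesis using Suc.IH Suc.prems by (simp add: x_def z_def algebra_simps)
    qed
  qed
  from this[of n] show ?thesis using powr_ge_zero[of "m n" "1 - p"] by linarith
qed

subsection \<open>Blow-up on cylinders\<close>

text \<open>The factor in \<open>G_lower\<close> covers \<open>x - y\<close> with \<open>norm x, norm y \<le> t powr (1 / \<theta>)\<close> at times
  \<open>t - s \<ge> t / 2\<close>.\<close>
locale kernel_lower =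
  fixes G :: "'a::euclidean_space \<Rightarrow> real \<Rightarrow> real" and \<theta> p c N :: real
  assumes N_eq: "N = real DIM('a)" and \<theta>: "0 < \<theta>" "\<theta> \<le> 2" and p: "1 < p" and c: "0 < c"
    and G_lower: "\<And>x t. \<lbrakk>t > 0; norm x \<le> 2 * 2 powr (1 / \<theta>) * t powr (1 / \<theta>)\<rbrakk> \<Longrightarrow>
      c * t powr (- N / \<theta>) \<le> G x t"
begin

abbreviation "\<omega> \<equiv> unit_ball_vol N"

lemma \<omega>_pos: "\<omega> > 0"
  by (simp add: N_eq)

lemma N_pos: "N > 0"
  by (simp add: N_eq)

definition duhamel :: "('a \<times> real \<Rightarrow> real) \<Rightarrow> 'a \<Rightarrow> real \<Rightarrow> ennreal" where
  "duhamel u x t = (\<integral>\<^sup>+ s\<in>{0<..<t}.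
     (\<integral>\<^sup>+ y. ennreal (G (x - y) (t - s) * u (y, s) powr p) \<partial>lebesgue) \<partial>lebesgue)"

text \<open>Only this inequality is iterated. It is stated over \<open>lborel\<close> on all of
  space-time, rather than over \<open>lebesgue_on\<close>, to make Fubini applicable.\<close>

definition supersolution :: "'a measure \<Rightarrow> ennreal \<Rightarrow> ('a \<times> real \<Rightarrow> real) \<Rightarrow> bool" where
  "supersolution \<mu> T u \<longleftrightarrow>
     (AE z in lborel. 0 < snd z \<and> ennreal (snd z) < T \<longrightarrow> 0 \<le> u z \<and>
        (\<integral>\<^sup>+ y. ennreal (G (fst z - y) (snd z)) \<partial>\<mu>) + duhamel u (fst z) (snd z) \<le> ennreal (u z))"

lemma cauchy_solution_supersolution:
  assumes "cauchy_solution G p \<mu> T u"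
  shows "supersolution \<mu> T u"
proof -
  have "slab T = (UNIV :: 'a set) \<times> ({0<..} \<inter> {t. ennreal t < T})"
    by (auto simp: slab_def)
  moreover have "{0<..} \<inter> {t. ennreal t < T} \<in> sets borel" by measurable
  ultimately have "slab T \<in> sets (borel :: ('a \<times> real) measure)"
    unfolding borel_prod[symmetric] by simp
  then have S: "slab T \<inter> space lebesgue \<in> sets (lebesgue :: ('a \<times> real) measure)"
    by (simp add: sets_completionI_sets)
  have "AE (x, t) in lebesgue_on (slab T). ennreal (u (x, t)) =
      (\<integral>\<^sup>+ y. ennreal (G (x - y) t) \<partial>\<mu>) + duhamel u x t"
    using assms unfolding cauchy_solution_def duhamel_def by blast
  then have "AE z in lborel. z \<in> slab T \<longrightarrow> ennreal (u z) =
      (\<integral>\<^sup>+ y. ennreal (G (fst z - y) (snd z)) \<partial>\<mu>) + duhamel u (fst z) (snd z)"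
    unfolding AE_restrict_space_iff[OF S] AE_completion_iff by (simp add: case_prod_beta)
  then show ?thesis
    unfolding supersolution_def
    by (rule eventually_mono) (use assms in \<open>auto simp: cauchy_solution_def slab_def\<close>)
qed

text \<open>The integrand need not be measurable; this is harmless, as \<open>nn_integral\<close> is monotone for arbitrary
  integrands.\<close>
lemma inner_lower:
  assumes u: "AE y in lborel. norm y \<le> \<rho> \<longrightarrow> a \<le> u (y, s)" and a: "a \<ge> 0" and g: "g \<ge> 0" and r: "r \<ge> 0"
    and sub: "cball z r \<subseteq> cball 0 \<rho>"
    and G: "\<And>y. y \<in> cball z r \<Longrightarrow> g \<le> G (x - y) \<tau>"
  shows "ennreal (g * a powr p * (\<omega> * r ^ DIM('a))) \<le>
    (\<integral>\<^sup>+ y. ennreal (G (x - y) \<tau> * u (y, s) powr p) \<partial>lebesgue)"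
proof -
  have "ennreal (g * a powr p * (\<omega> * r ^ DIM('a))) = ennreal (g * a powr p) * emeasure lborel (cball z r)"
    using a g r by (simp add: emeasure_cball N_eq ennreal_mult'')
  also have "\<dots> = (\<integral>\<^sup>+ y. ennreal (g * a powr p) * indicator (cball z r) y \<partial>lborel)"
    by (subst nn_integral_cmult_indicator) auto
  also have "\<dots> \<le> (\<integral>\<^sup>+ y. ennreal (G (x - y) \<tau> * u (y, s) powr p) \<partial>lborel)"
  proof (rule nn_integral_mono_AE, rule eventually_mono[OF u])
    fix y assume y: "norm y \<le> \<rho> \<longrightarrow> a \<le> u (y, s)"
    show "ennreal (g * a powr p) * indicator (cball z r) y \<le> ennreal (G (x - y) \<tau> * u (y, s) powr p)"
    proof (cases "y \<in> cball z r")
      case True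
      then have "g \<le> G (x - y) \<tau>" "a \<le> u (y, s)" using y G sub by auto
      then have "g * a powr p \<le> G (x - y) \<tau> * u (y, s) powr p"
        using g a p by (intro mult_mono powr_mono2) auto
      then show ?thesis using True by (simp add: ennreal_leI)
    qed auto
  qed
  finally show ?thesis by (simp add: nn_integral_completion)
qed

lemma powr_dim: "\<tau> > 0 \<Longrightarrow> (\<tau> powr (1 / \<theta>)) ^ DIM('a) = \<tau> powr (N / \<theta>)"
  by (simp add: N_eq powr_powr flip: powr_realpow)

text \<open>The Duhamel term is restricted to \<open>t - \<tau> < s < t - \<tau> / 2\<close> and to
  the ball of radius \<open>\<tau> powr (1 / \<theta>)\<close> around \<open>x\<close>, where the
  kernel is at least \<open>c * \<tau> powr (- N / \<theta>)\<close>. The price is a later start and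
  a smaller radius, so that window and ball stay inside the old cylinder.\<close>

lemma above_step:
  assumes sol: "supersolution \<mu> T u" and ab: "above u a \<rho> t\<^sub>1 t\<^sub>2"
    and "0 \<le> t\<^sub>1" "ennreal t\<^sub>2 \<le> T" "0 \<le> a" "0 < \<tau>" and \<rho>': "\<rho>' + \<tau> powr (1 / \<theta>) \<le> \<rho>"
  shows "above u (c * \<omega> / 2 * \<tau> * a powr p) \<rho>' (t\<^sub>1 + \<tau>) t\<^sub>2"
  unfolding above_def
proof (rule eventually_mono[OF sol[unfolded supersolution_def]], rule impI)
  fix z assume z: "0 < snd z \<and> ennreal (snd z) < T \<longrightarrow> 0 \<le> u z \<and>
        (\<integral>\<^sup>+ y. ennreal (G (fst z - y) (snd z)) \<partial>\<mu>) + duhamel u (fst z) (snd z) \<le> ennreal (u z)"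
    and "norm (fst z) \<le> \<rho>' \<and> t\<^sub>1 + \<tau> < snd z \<and> snd z < t\<^sub>2"
  moreover obtain x t where xt: "z = (x, t)" by (cases z)
  ultimately have x: "norm x \<le> \<rho>'" and t: "t\<^sub>1 + \<tau> < t" "t < t\<^sub>2" by auto
  have "ennreal t < ennreal t\<^sub>2" using t assms by (intro ennreal_lessI) auto
  then have "ennreal t < T" using assms(4) by (rule less_le_trans)
  then have uz: "0 \<le> u z" "duhamel u x t \<le> ennreal (u z)"
    using z xt t assms by (auto intro: order_trans[rotated])
  \<comment> \<open>The volume of the ball cancels the decay of the kernel, so the only power of
    \<open>\<tau>\<close> in the result is the length \<open>\<tau> / 2\<close> of the
    window.\<close>
  have 1: "c * \<tau> powr (- N / \<theta>) * a powr p * (\<omega> * (\<tau> powr (1 / \<theta>)) ^ DIM('a)) = c * \<omega> * a powr p"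
    using \<open>0 < \<tau>\<close> by (simp add: powr_dim powr_minus)
  have "ennreal (c * \<omega> / 2 * \<tau> * a powr p) = ennreal (c * \<omega> * a powr p) * ennreal (\<tau> / 2)"
    using c \<omega>_pos \<open>0 < \<tau>\<close> by (simp add: ennreal_mult''[symmetric] mult_ac)
  also have "\<dots> = (\<integral>\<^sup>+ s. ennreal (c * \<omega> * a powr p) * indicator {t - \<tau><..<t - \<tau> / 2} s \<partial>lborel)"
    using \<open>0 < \<tau>\<close> by (subst nn_integral_cmult_indicator) auto
  also have "\<dots> \<le> (\<integral>\<^sup>+ s. (\<integral>\<^sup>+ y. ennreal (G (x - y) (t - s) * u (y, s) powr p) \<partial>lebesgue) *
      indicator {0<..<t} s \<partial>lborel)"
  proof (rule nn_integral_mono_AE, rule eventually_mono[OF above_slices[OF ab]])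
    fix s assume s: "t\<^sub>1 < s \<and> s < t\<^sub>2 \<longrightarrow> (AE y in lborel. norm y \<le> \<rho> \<longrightarrow> a \<le> u (y, s))"
    show "ennreal (c * \<omega> * a powr p) * indicator {t - \<tau><..<t - \<tau> / 2} s \<le>
      (\<integral>\<^sup>+ y. ennreal (G (x - y) (t - s) * u (y, s) powr p) \<partial>lebesgue) * indicator {0<..<t} s"
    proof (cases "s \<in> {t - \<tau><..<t - \<tau> / 2}")
      case True
      then have st: "t\<^sub>1 < s" "s < t" "t - s > 0" "t - s \<le> \<tau>" "\<tau> \<le> 2 * (t - s)" using t assms by auto
      have "ennreal (c * \<tau> powr (- N / \<theta>) * a powr p * (\<omega> * (\<tau> powr (1 / \<theta>)) ^ DIM('a))) \<le>
        (\<integral>\<^sup>+ y. ennreal (G (x - y) (t - s) * u (y, s) powr p) \<partial>lebesgue)"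
      proof (rule inner_lower[where \<rho> = \<rho> and z = x])
        show "AE y in lborel. norm y \<le> \<rho> \<longrightarrow> a \<le> u (y, s)" using s st t by auto
        show "cball x (\<tau> powr (1 / \<theta>)) \<subseteq> cball 0 \<rho>"
        proof
          fix y assume "y \<in> cball x (\<tau> powr (1 / \<theta>))"
          then show "y \<in> cball 0 \<rho>"
            using x \<rho>' norm_triangle_ineq4[of x "x - y"] by (simp add: dist_norm)
        qed
        fix y assume "y \<in> cball x (\<tau> powr (1 / \<theta>))"
        then have "norm (x - y) \<le> \<tau> powr (1 / \<theta>)" by (simp add: dist_norm)
        also have "\<dots> \<le> (2 * (t - s)) powr (1 / \<theta>)" using st \<theta> \<open>0 < \<tau>\<close> by (intro powr_mono2) auto
        also have "\<dots> = 2 powr (1 / \<theta>) * (t - s) powr (1 / \<theta>)" by (rule powr_mult)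
        also have "\<dots> \<le> 2 * 2 powr (1 / \<theta>) * (t - s) powr (1 / \<theta>)" by simp
        finally have "c * (t - s) powr (- N / \<theta>) \<le> G (x - y) (t - s)" using st by (intro G_lower) auto
        moreover have "\<tau> powr (- N / \<theta>) \<le> (t - s) powr (- N / \<theta>)" using st \<theta> N_pos by (intro powr_mono2') auto
        ultimately show "c * \<tau> powr (- N / \<theta>) \<le> G (x - y) (t - s)"
          using c by (meson mult_left_mono less_imp_le order_trans)
      qed (use assms c in auto)
      then show ?thesis using True st assms unfolding 1 by (simp add: indicator_def)
    qed auto
  qed
  also have "\<dots> = duhamel u x t" by (simp add: duhamel_def nn_integral_completion)
  also note uz(2)
  finally show "c * \<omega> / 2 * \<tau> * a powr p \<le> u z" using uz(1) by (simp add: ennreal_le_iff)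
qed

text \<open>Chosen so that one step of the iteration multiplies the bound by exactly 4^(1/(p-1)): 32
  is the 2 of \<open>above_step\<close> times the 16 of the first waiting time.\<close>

definition "B \<equiv> (32 * 4 powr (1 / (p - 1)) / (c * \<omega>)) powr (1 / (p - 1))"

lemma B_pos: "B > 0"
  using c \<omega>_pos by (simp add: B_def)

text \<open>Iterating \<open>above_step\<close> with waiting times \<open>R powr \<theta> / 16 * (1 / 4) ^ k\<close>, which sum to
  \<open>R powr \<theta> / 12\<close>; the radii stay above \<open>R / 2\<close> because \<open>\<theta> \<le> 2\<close>. The growth rate
  \<open>q = 4 powr (1 / (p - 1))\<close> compensates the factor \<open>(1 / 4) ^ k\<close>.\<close>
lemma not_above_large:
  assumes sol: "supersolution \<mu> T u" and R: "R > 0" and "0 \<le> t\<^sub>0" "ennreal (t\<^sub>0 + R powr \<theta>) \<le> T"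
    and ab: "above u (B * R powr (- \<theta> / (p - 1))) R t\<^sub>0 (t\<^sub>0 + R powr \<theta>)"
  shows False
proof -
  define q where "q = 4 powr (1 / (p - 1))"
  define A where "A = R powr (- \<theta> / (p - 1))"
  have q: "q > 1" "q powr (p - 1) = 4" using p by (auto simp: q_def powr_powr)
  have Bp: "B powr (p - 1) = 32 * q / (c * \<omega>)"
    using p c \<omega>_pos by (simp add: B_def powr_powr q_def)
  \<comment> \<open>Scale invariance of the equation: amplitude R^(-\<theta>/(p-1)) belongs to
    duration R^\<theta>.\<close>
  have Ap: "R powr \<theta> * A powr p = A"
    using R p by (simp add: A_def powr_powr flip: powr_add) (simp add: field_simps)
  have claim: "above u (B * q ^ k * A) (R / 2 + R / 2 ^ Suc k)
      (t\<^sub>0 + R powr \<theta> * (1 - (1 / 4) ^ k) / 12) (t\<^sub>0 + R powr \<theta>)" for k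
  proof (induction k)
    case 0
    then show ?case using ab by (simp add: A_def)
  next
    case (Suc k)
    define \<tau> where "\<tau> = R powr \<theta> / 16 * (1 / 4) ^ k"
    have \<tau>: "\<tau> > 0" using R by (simp add: \<tau>_def)
    have "\<tau> = R powr \<theta> * (1 / 4) ^ Suc (Suc k)" by (simp add: \<tau>_def)
    then have "\<tau> powr (1 / \<theta>) = R * ((1 / 4) ^ Suc (Suc k)) powr (1 / \<theta>)"
      using R \<theta> by (simp only: powr_mult powr_powr) simp
    \<comment> \<open>The base is at most 1 and the exponent \<open>1 / \<theta>\<close> at least
      1/2. The resulting \<open>R / 2 ^ Suc (Suc k)\<close> is exactly the radius given up from
      \<open>k\<close> to \<open>Suc k\<close>.\<close>
    also have "\<dots> \<le> R * ((1 / 4) ^ Suc (Suc k)) powr (1 / 2)"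
    proof (intro mult_left_mono powr_mono')
      show "(1 / 4 :: real) ^ Suc (Suc k) \<le> 1" by (rule power_le_one) auto
    qed (use R \<theta> in \<open>auto simp: field_simps\<close>)
    also have "((1 / 4 :: real) ^ Suc (Suc k)) powr (1 / 2) = (1 / 2) ^ Suc (Suc k)"
      by (simp add: powr_half_sqrt real_sqrt_power real_sqrt_divide)
    finally have r: "\<tau> powr (1 / \<theta>) \<le> R * (1 / 2) ^ Suc (Suc k)" .
    have "above u (c * \<omega> / 2 * \<tau> * (B * q ^ k * A) powr p) (R / 2 + R / 2 ^ Suc (Suc k))
      (t\<^sub>0 + R powr \<theta> * (1 - (1 / 4) ^ k) / 12 + \<tau>) (t\<^sub>0 + R powr \<theta>)"
    proof (rule above_step[OF sol Suc])
      show "0 \<le> t\<^sub>0 + R powr \<theta> * (1 - (1 / 4) ^ k) / 12"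
        using assms(3) by (simp add: power_le_one)
      show "R / 2 + R / 2 ^ Suc (Suc k) + \<tau> powr (1 / \<theta>) \<le> R / 2 + R / 2 ^ Suc k"
        using r by (simp add: power_one_over field_simps)
    qed (use assms(4) B_pos q \<tau> in \<open>auto simp: A_def\<close>)
    moreover have "c * \<omega> / 2 * \<tau> * (B * q ^ k * A) powr p = B * q ^ Suc k * A"
    proof -
      have "(B * q ^ k * A) powr p = B powr p * (q ^ k) powr p * A powr p"
        using B_pos q by (simp add: powr_mult A_def)
      moreover have "B powr p = B * (32 * q / (c * \<omega>))"
        using Bp B_pos powr_add[of B 1 "p - 1"] by simp
      moreover have "(q ^ k) powr p = q ^ k * 4 ^ k"
      proof -
        have "(q ^ k) powr p = q ^ k * (q ^ k) powr (p - 1)"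
          using q powr_add[of "q ^ k" 1 "p - 1"] by simp
        also have "(q ^ k) powr (p - 1) = (q powr (p - 1)) ^ k"
          using q(1) by (simp add: powr_powr mult_ac flip: powr_realpow)
        finally show ?thesis using q by simp
      qed
      ultimately have "c * \<omega> / 2 * \<tau> * (B * q ^ k * A) powr p =
         B * q ^ Suc k * (R powr \<theta> * A powr p)"
        using c \<omega>_pos by (simp add: \<tau>_def power_one_over field_simps)
      then show ?thesis by (simp add: Ap)
    qed
    moreover have "t\<^sub>0 + R powr \<theta> * (1 - (1 / 4) ^ k) / 12 + \<tau> = t\<^sub>0 + R powr \<theta> * (1 - (1 / 4) ^ Suc k) / 12"
      by (simp add: \<tau>_def field_simps)
    ultimately show ?case by simp
  qed
  show False
  proof (rule not_above_unbounded)
    show "above u (B * q ^ k * A) (R / 2) (t\<^sub>0 + R powr \<theta> / 12) (t\<^sub>0 + R powr \<theta>)" for k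
      by (rule above_mono[OF claim[of k]]) (use R in \<open>auto simp: field_simps\<close>)
    have "filterlim (\<lambda>k. q ^ k) at_top sequentially" 
      by (rule filterlim_at_infinity_imp_filterlim_at_top[OF filterlim_realpow_sequentially_gt1])
        (use q(1) in auto)
    then have "filterlim (\<lambda>k. B * A * q ^ k) at_top sequentially"
      using B_pos R by (intro filterlim_tendsto_pos_mult_at_top[OF tendsto_const]) (auto simp: A_def)
    then show "filterlim (\<lambda>k. B * q ^ k * A) at_top sequentially" by (simp add: mult_ac)
  qed (use R in auto)
qed

section \<open>The mass of the initial data in a parabolic ball\<close>

lemma initial_lower:
  assumes "sets \<mu> = sets borel" "t > 0" "\<sigma> \<le> t powr (1 / \<theta>)" "norm x \<le> t powr (1 / \<theta>)"
  shows "ennreal (c * t powr (- N / \<theta>)) * emeasure \<mu> (cball 0 \<sigma>) \<le> (\<integral>\<^sup>+ y. ennreal (G (x - y) t) \<partial>\<mu>)"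
proof -
  have "ennreal (c * t powr (- N / \<theta>)) * emeasure \<mu> (cball 0 \<sigma>) =
      (\<integral>\<^sup>+ y. ennreal (c * t powr (- N / \<theta>)) * indicator (cball 0 \<sigma>) y \<partial>\<mu>)"
    using assms(1) by (subst nn_integral_cmult_indicator) auto
  also have "\<dots> \<le> (\<integral>\<^sup>+ y. ennreal (G (x - y) t) \<partial>\<mu>)"
  proof (rule nn_integral_mono)
    fix y
    have "c * t powr (- N / \<theta>) \<le> G (x - y) t" if "norm y \<le> \<sigma>"
    proof (rule G_lower[OF assms(2)])
      have "2 powr (1 / \<theta>) \<ge> (1 :: real)" using \<theta> by (intro ge_one_powr_ge_zero) auto
      then have "1 * t powr (1 / \<theta>) \<le> 2 powr (1 / \<theta>) * t powr (1 / \<theta>)" by (intro mult_right_mono) auto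
      moreover have "norm (x - y) \<le> norm x + norm y" by (rule norm_triangle_ineq4)
      ultimately show "norm (x - y) \<le> 2 * 2 powr (1 / \<theta>) * t powr (1 / \<theta>)" using that assms by linarith
    qed
    then show "ennreal (c * t powr (- N / \<theta>)) * indicator (cball 0 \<sigma>) y \<le> ennreal (G (x - y) t)"
      by (auto simp: indicator_def intro!: ennreal_leI)
  qed
  finally show ?thesis .
qed

text \<open>On the ball of radius \<open>R = t powr (1 / \<theta>)\<close> and between
  \<open>t\<close> and \<open>2 * t = t + R powr \<theta>\<close>, the linear term alone is at least
  \<open>c * (2 * t) powr (- N / \<theta>) * M\<close>. A larger \<open>M\<close> would lift this to
  the threshold of \<open>not_above_large\<close>.\<close>

lemma mass_bound:
  assumes sol: "supersolution \<mu> T u" and \<mu>: "sets \<mu> = sets borel" and t: "t > 0" "ennreal (2 * t) \<le> T"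
    and M: "M \<ge> 0" "ennreal M \<le> emeasure \<mu> (cball 0 (t powr (1 / \<theta>)))"
  shows "M \<le> B * 2 powr (N / \<theta>) / c * t powr (N / \<theta> - 1 / (p - 1))"
proof (rule ccontr)
  assume less: "\<not> ?thesis"
  define R where "R = t powr (1 / \<theta>)"
  have R: "R > 0" "R powr \<theta> = t" using t \<theta> by (auto simp: R_def powr_powr)
  define a where "a = c * (2 * t) powr (- N / \<theta>) * M"
  have "above u a R t (2 * t)"
    unfolding above_def
  proof (rule eventually_mono[OF sol[unfolded supersolution_def]], rule impI)
    fix z assume z: "0 < snd z \<and> ennreal (snd z) < T \<longrightarrow> 0 \<le> u z \<and>
        (\<integral>\<^sup>+ y. ennreal (G (fst z - y) (snd z)) \<partial>\<mu>) + duhamel u (fst z) (snd z) \<le> ennreal (u z)"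
      and zR: "norm (fst z) \<le> R \<and> t < snd z \<and> snd z < 2 * t"
    have "ennreal (snd z) < ennreal (2 * t)" using zR t by (intro ennreal_lessI) auto
    then have "ennreal (snd z) < T" using t(2) by (rule less_le_trans)
    then have uz: "0 \<le> u z" "(\<integral>\<^sup>+ y. ennreal (G (fst z - y) (snd z)) \<partial>\<mu>) \<le> ennreal (u z)"
      using z zR t by (auto intro: order_trans[rotated])
    have "a \<le> c * snd z powr (- N / \<theta>) * M"
      unfolding a_def using zR t c M \<theta> N_pos by (intro mult_right_mono mult_left_mono powr_mono2') auto
    then have "ennreal a \<le> ennreal (c * snd z powr (- N / \<theta>)) * ennreal M"
      using c M by (simp add: ennreal_mult[symmetric] ennreal_leI)
    also have "\<dots> \<le> ennreal (c * snd z powr (- N / \<theta>)) * emeasure \<mu> (cball 0 R)"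
      using M(2) by (intro mult_left_mono) (auto simp: R_def)
    also have "\<dots> \<le> (\<integral>\<^sup>+ y. ennreal (G (fst z - y) (snd z)) \<partial>\<mu>)"
    proof (rule initial_lower[OF \<mu>])
      have "R \<le> snd z powr (1 / \<theta>)" unfolding R_def using zR t \<theta> by (intro powr_mono2) auto
      then show "R \<le> snd z powr (1 / \<theta>)" "norm (fst z) \<le> snd z powr (1 / \<theta>)" using zR by auto
    qed (use zR t in auto)
    also note uz(2)
    finally show "a \<le> u z" using uz(1) by (simp add: ennreal_le_iff)
  qed
  moreover have "B * R powr (- \<theta> / (p - 1)) \<le> a"
  proof -
    have "R powr (- \<theta> / (p - 1)) = t powr (- 1 / (p - 1))"
      using \<theta> by (simp add: R_def powr_powr)
    moreover have "t powr (N / \<theta> - 1 / (p - 1)) = t powr (N / \<theta>) * t powr (- 1 / (p - 1))"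
      by (simp flip: powr_add)
    moreover have "(2 * t) powr (- N / \<theta>) = 1 / (2 powr (N / \<theta>) * t powr (N / \<theta>))"
      using t by (simp add: powr_minus powr_mult divide_inverse)
    ultimately show ?thesis
      using less t c unfolding a_def by (simp add: pos_le_divide_eq not_le) (simp add: field_simps)
  qed
  ultimately have "above u (B * R powr (- \<theta> / (p - 1))) R t (t + R powr \<theta>)"
    using R by (elim above_mono) auto
  from not_above_large[OF sol R(1) _ _ this] show False using t R by simp
qed

end

subsection \<open>The critical exponent\<close>

fun delayed_seq :: "real \<Rightarrow> real \<Rightarrow> real \<Rightarrow> nat \<Rightarrow> real" where
  "delayed_seq p b M 0 = M"
| "delayed_seq p b M (Suc 0) = M"
| "delayed_seq p b M (Suc (Suc k)) = delayed_seq p b M (Suc k) + b * delayed_seq p b M k powr p"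

text \<open>The Duhamel integral supplies the sum over all earlier intervals, not an increment.
  Truncated subtraction makes the sum empty for \<open>k = 0\<close> and
  \<open>k = 1\<close>.\<close>

lemma delayed_seq_sum: "delayed_seq p b M k = M + b * (\<Sum>j<k - 1. delayed_seq p b M j powr p)"
proof (cases k)
  case (Suc n)
  have "delayed_seq p b M (Suc n) = M + b * (\<Sum>j<n. delayed_seq p b M j powr p)"
    by (induction n) (auto simp: algebra_simps)
  then show ?thesis using Suc by simp
qed auto

lemma delayed_seq_nonneg: "M \<ge> 0 \<Longrightarrow> b \<ge> 0 \<Longrightarrow> delayed_seq p b M k \<ge> 0"
  by (subst delayed_seq_sum) (auto intro!: add_nonneg_nonneg mult_nonneg_nonneg sum_nonneg)

context kernel_lower
begin

text \<open>The contribution of one dyadic interval, relative to the kernel bound and to the p-th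
  power of its mass: c^p from the amplitude, \<omega> from the ball, and 2^(-N/\<theta>) / 2 =
  2^(-Np/\<theta>) at the critical exponent because the amplitude is measured at the end of the
  interval.\<close>

definition "gain \<equiv> c powr p * \<omega> * 2 powr (- N / \<theta>) / 2"

lemma gain_pos: "gain > 0"
  using c \<omega>_pos by (simp add: gain_def)

text \<open>The linear term yields \<open>M\<close>, and each interval \<open>j < k - 1\<close> adds
  \<open>gain\<close> times the p-th power of its mass. These intervals end before
  \<open>t / 2\<close>, so the kernel between them and time \<open>t\<close> is as large as the
  linear one, up to constants.\<close>

lemma above_dyadic:
  assumes crit: "p = 1 + \<theta> / N"
    and sol: "supersolution \<mu> T u" and \<mu>: "sets \<mu> = sets borel" and \<sigma>: "\<sigma> > 0"
    and M: "M \<ge> 0" "ennreal M \<le> emeasure \<mu> (cball 0 \<sigma>)"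
  defines "\<tau> \<equiv> \<lambda>k::nat. 2 ^ k * \<sigma> powr \<theta>"
  assumes T: "ennreal (\<tau> (Suc k)) \<le> T"
  shows "above u (c * \<tau> (Suc k) powr (- N / \<theta>) * delayed_seq p gain M k) (\<tau> k powr (1 / \<theta>)) (\<tau> k) (\<tau> (Suc k))"
  using T
proof (induction k rule: less_induct)
  case (less k)
  let ?m = "delayed_seq p gain M"
  have \<tau>: "\<tau> j > 0" "\<tau> (Suc j) = 2 * \<tau> j" for j using \<sigma> by (auto simp: \<tau>_def)
  have \<tau>_mono: "i \<le> j \<Longrightarrow> \<tau> i \<le> \<tau> j" for i j by (simp add: \<tau>_def power_increasing mult_right_mono)
  have m0: "?m j \<ge> 0" for j using M gain_pos by (simp add: delayed_seq_nonneg)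
  have ab: "above u (c * \<tau> (Suc j) powr (- N / \<theta>) * ?m j) (\<tau> j powr (1 / \<theta>)) (\<tau> j) (\<tau> (Suc j))"
    if "j < k - 1" for j
  proof (rule less.IH)
    have "ennreal (\<tau> (Suc j)) \<le> ennreal (\<tau> (Suc k))" using that by (intro ennreal_leI \<tau>_mono) auto
    then show "ennreal (\<tau> (Suc j)) \<le> T" using less.prems by (rule order_trans)
  qed (use that in auto)
  define g where "g = c * \<tau> (Suc k) powr (- N / \<theta>)"
  have g: "g > 0" using c \<tau>[of k] by (simp add: g_def)
  define K where "K j = g * (c * \<tau> (Suc j) powr (- N / \<theta>) * ?m j) powr p * (\<omega> * (\<tau> j powr (1 / \<theta>)) ^ DIM('a))" for j
  have K0: "K j \<ge> 0" for j using g c \<omega>_pos m0[of j] by (simp add: K_def)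
  have K: "K j * \<tau> j = g * (gain * ?m j powr p)" for j
  proof -
    have 1: "(c * \<tau> (Suc j) powr (- N / \<theta>) * ?m j) powr p = c powr p * \<tau> (Suc j) powr (- N / \<theta> * p) * ?m j powr p"
      using c \<tau>[of j] m0[of j] by (simp add: powr_mult powr_powr)
    \<comment> \<open>Here criticality makes all powers of \<open>\<tau> j\<close> cancel: the
      amplitude gives \<open>- N / \<theta> - 1\<close>, the ball \<open>N / \<theta>\<close> and
      the interval length 1.\<close>
    have "- N / \<theta> * p = - N / \<theta> - 1" using crit \<theta> N_pos by (simp add: field_simps)
    then have 2: "\<tau> (Suc j) powr (- N / \<theta> * p) = 2 powr (- N / \<theta>) / 2 * (\<tau> j powr (- N / \<theta>) / \<tau> j)"
      using \<tau>[of j] by (simp add: powr_mult powr_diff)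
    have "\<tau> j powr (- N / \<theta>) * \<tau> j powr (N / \<theta>) = 1" using \<tau>[of j] by (simp flip: powr_add)
    then have 3: "\<tau> j powr (- N / \<theta>) / \<tau> j * \<tau> j powr (N / \<theta>) * \<tau> j = 1" using \<tau>[of j] by simp
    define w where "w = ?m j powr p"
    have "K j * \<tau> j = g * (gain * w) * (\<tau> j powr (- N / \<theta>) / \<tau> j * \<tau> j powr (N / \<theta>) * \<tau> j)"
      unfolding K_def 1 2 powr_dim[OF \<tau>(1)] w_def[symmetric] by (simp add: gain_def mult_ac)
    then show ?thesis unfolding 3 w_def by simp
  qed
  \<comment> \<open>Finitely many intervals are involved, so a single null set of times serves them
    all.\<close>
  have slices: "AE s in lborel. \<forall>j\<in>{..<k - 1}. \<tau> j < s \<and> s < \<tau> (Suc j) \<longrightarrow>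
      (AE y in lborel. norm y \<le> \<tau> j powr (1 / \<theta>) \<longrightarrow> c * \<tau> (Suc j) powr (- N / \<theta>) * ?m j \<le> u (y, s))"
    using above_slices[OF ab] by (intro eventually_ball_finite) auto
  show ?case
    unfolding above_def
  proof (rule eventually_mono[OF sol[unfolded supersolution_def]], rule impI)
    fix z assume z: "0 < snd z \<and> ennreal (snd z) < T \<longrightarrow> 0 \<le> u z \<and>
        (\<integral>\<^sup>+ y. ennreal (G (fst z - y) (snd z)) \<partial>\<mu>) + duhamel u (fst z) (snd z) \<le> ennreal (u z)"
      and xtz: "norm (fst z) \<le> \<tau> k powr (1 / \<theta>) \<and> \<tau> k < snd z \<and> snd z < \<tau> (Suc k)"
    moreover obtain x t where xt: "z = (x, t)" by (cases z)
    ultimately have x: "norm x \<le> \<tau> k powr (1 / \<theta>)" and t: "\<tau> k < t" "t < \<tau> (Suc k)" by auto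
    have t0: "t > 0" using t \<tau>(1)[of k] by linarith
    have "ennreal t < ennreal (\<tau> (Suc k))" using t t0 by (intro ennreal_lessI) auto
    then have "ennreal t < T" using less.prems by (rule less_le_trans)
    then have uz: "0 \<le> u z" "(\<integral>\<^sup>+ y. ennreal (G (x - y) t) \<partial>\<mu>) + duhamel u x t \<le> ennreal (u z)"
      using z xt t0 by auto
    have xt': "norm x \<le> t powr (1 / \<theta>)"
      using x powr_mono2[of "1 / \<theta>" "\<tau> k" t] t \<theta> \<tau>[of k] by auto
    have "ennreal (g * M) \<le> ennreal (c * t powr (- N / \<theta>)) * ennreal M"
      using c M t t0 \<theta> N_pos unfolding g_def ennreal_mult''[OF M(1), symmetric]
      by (intro ennreal_leI mult_right_mono mult_left_mono powr_mono2') auto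
    also have "\<dots> \<le> ennreal (c * t powr (- N / \<theta>)) * emeasure \<mu> (cball 0 \<sigma>)"
      using M(2) by (intro mult_left_mono) auto
    also have "\<dots> \<le> (\<integral>\<^sup>+ y. ennreal (G (x - y) t) \<partial>\<mu>)"
    proof (rule initial_lower[OF \<mu> t0 _ xt'])
      have "\<sigma> = (\<tau> 0) powr (1 / \<theta>)" using \<sigma> \<theta> by (simp add: \<tau>_def powr_powr)
      also have "\<dots> \<le> t powr (1 / \<theta>)"
        using t \<tau>_mono[of 0 k] \<theta> \<tau>(1)[of 0] by (intro powr_mono2) auto
      finally show "\<sigma> \<le> t powr (1 / \<theta>)" .
    qed
    finally have I1: "ennreal (g * M) \<le> (\<integral>\<^sup>+ y. ennreal (G (x - y) t) \<partial>\<mu>)" .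
    have "ennreal (g * (gain * (\<Sum>j<k - 1. ?m j powr p))) = (\<Sum>j<k - 1. ennreal (K j) * ennreal (\<tau> j))"
      using K0 \<tau>(1) by (simp add: ennreal_mult[symmetric] less_imp_le sum_distrib_left K g gain_pos sum_ennreal)
    also have "\<dots> = (\<Sum>j<k - 1. \<integral>\<^sup>+ s. ennreal (K j) * indicator {\<tau> j<..<\<tau> (Suc j)} s \<partial>lborel)"
      using \<tau> by (intro sum.cong refl) (subst nn_integral_cmult_indicator, auto simp: less_imp_le)
    also have "\<dots> = (\<integral>\<^sup>+ s. (\<Sum>j<k - 1. ennreal (K j) * indicator {\<tau> j<..<\<tau> (Suc j)} s) \<partial>lborel)"
      by (subst nn_integral_sum) auto
    also have "\<dots> \<le> (\<integral>\<^sup>+ s. (\<integral>\<^sup>+ y. ennreal (G (x - y) (t - s) * u (y, s) powr p) \<partial>lebesgue) *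
        indicator {0<..<t} s \<partial>lborel)"
    proof (rule nn_integral_mono_AE, rule eventually_mono[OF slices])
      fix s assume s: "\<forall>j\<in>{..<k - 1}. \<tau> j < s \<and> s < \<tau> (Suc j) \<longrightarrow>
        (AE y in lborel. norm y \<le> \<tau> j powr (1 / \<theta>) \<longrightarrow> c * \<tau> (Suc j) powr (- N / \<theta>) * ?m j \<le> u (y, s))"
      show "(\<Sum>j<k - 1. ennreal (K j) * indicator {\<tau> j<..<\<tau> (Suc j)} s) \<le>
        (\<integral>\<^sup>+ y. ennreal (G (x - y) (t - s) * u (y, s) powr p) \<partial>lebesgue) * indicator {0<..<t} s"
      proof (cases "\<exists>j<k - 1. s \<in> {\<tau> j<..<\<tau> (Suc j)}")
        case False
        then have "(\<Sum>j<k - 1. ennreal (K j) * indicator {\<tau> j<..<\<tau> (Suc j)} s) = 0"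
          by (intro sum.neutral) (auto simp: indicator_def)
        then show ?thesis by simp
      next
        case True
        then obtain j where j: "j < k - 1" "\<tau> j < s" "s < \<tau> (Suc j)" by auto
        have other: "s \<notin> {\<tau> i<..<\<tau> (Suc i)}" if "i \<noteq> j" for i
          using that j \<tau>_mono[of "Suc i" j] \<tau>_mono[of "Suc j" i] by (cases "i < j") auto
        have "(\<Sum>j<k - 1. ennreal (K j) * indicator {\<tau> j<..<\<tau> (Suc j)} s) =
            (\<Sum>i<k - 1. if i = j then ennreal (K j) else 0)"
          using other j by (intro sum.cong) (auto simp: indicator_def)
        also have "\<dots> = ennreal (K j)" using j by simp
        finally have sum: "(\<Sum>j<k - 1. ennreal (K j) * indicator {\<tau> j<..<\<tau> (Suc j)} s) = ennreal (K j)" .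
        have s0: "s > 0" using j(2) \<tau>(1)[of j] by linarith
        \<comment> \<open>The skipped interval \<open>k - 1\<close> is what gives
          \<open>2 * s < t\<close>.\<close>
        have "2 * s \<le> 2 * \<tau> (Suc j)" using j by simp
        also have "\<dots> \<le> \<tau> k" using \<tau>_mono[of "Suc (Suc j)" k] j \<tau>(2)[of "Suc j"] by simp
        finally have st: "s < t" "2 * (t - s) \<ge> t" using t s0 by auto
        have "ennreal (K j) \<le> (\<integral>\<^sup>+ y. ennreal (G (x - y) (t - s) * u (y, s) powr p) \<partial>lebesgue)"
          unfolding K_def
        proof (rule inner_lower[where \<rho> = "\<tau> j powr (1 / \<theta>)" and z = 0])
          show "AE y in lborel. norm y \<le> \<tau> j powr (1 / \<theta>) \<longrightarrow> c * \<tau> (Suc j) powr (- N / \<theta>) * ?m j \<le> u (y, s)"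
            using s j by auto
          fix y :: 'a assume "y \<in> cball 0 (\<tau> j powr (1 / \<theta>))"
          then have "norm y \<le> \<tau> j powr (1 / \<theta>)" by simp
          also have "\<dots> \<le> t powr (1 / \<theta>)" using \<theta> j st \<tau>(1)[of j] by (intro powr_mono2) auto
          finally have "norm (x - y) \<le> 2 * t powr (1 / \<theta>)"
            using xt' norm_triangle_ineq4[of x y] by linarith
          also have "t powr (1 / \<theta>) \<le> (2 * (t - s)) powr (1 / \<theta>)"
            using \<theta> st t0 by (intro powr_mono2) auto
          also have "(2 * (t - s)) powr (1 / \<theta>) = 2 powr (1 / \<theta>) * (t - s) powr (1 / \<theta>)"
            by (rule powr_mult)
          finally have "c * (t - s) powr (- N / \<theta>) \<le> G (x - y) (t - s)" using st by (intro G_lower) auto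
          moreover have "\<tau> (Suc k) powr (- N / \<theta>) \<le> (t - s) powr (- N / \<theta>)"
            using st t s0 \<theta> N_pos by (intro powr_mono2') auto
          ultimately show "g \<le> G (x - y) (t - s)"
            using c unfolding g_def by (meson mult_left_mono less_imp_le order_trans)
        qed (use g c m0[of j] in auto)
        then show ?thesis unfolding sum using st s0 by simp
      qed
    qed
    also have "\<dots> = duhamel u x t" by (simp add: duhamel_def nn_integral_completion)
    finally have I2: "ennreal (g * (gain * (\<Sum>j<k - 1. ?m j powr p))) \<le> duhamel u x t" .
    have "ennreal (g * ?m k) = ennreal (g * M) + ennreal (g * (gain * (\<Sum>j<k - 1. ?m j powr p)))"
      using g M gain_pos by (subst delayed_seq_sum, subst ennreal_plus[symmetric])
        (auto simp: distrib_left intro!: mult_nonneg_nonneg sum_nonneg)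
    also have "\<dots> \<le> ennreal (u z)" by (rule order_trans[OF add_mono[OF I1 I2] uz(2)])
    finally show "c * \<tau> (Suc k) powr (- N / \<theta>) * ?m k \<le> u z"
      using uz(1) by (simp add: ennreal_le_iff g_def)
  qed
qed

text \<open>No term of the mass sequence can exceed the blow-up threshold \<open>C\<close> within
  the lifespan, while the recursion leaves room for at most M^(1-p)/\<delta> + 1 such terms.
  \<open>D\<close> is fixed before the data, which makes the bound uniform in lambda.\<close>

lemma critical_bound:
  assumes crit: "p = 1 + \<theta> / N"
  obtains D where "D > 0"
    "\<And>\<mu> T u \<sigma> M. \<lbrakk>supersolution \<mu> T u; sets \<mu> = sets borel; \<sigma> > 0; M > 0; ennreal M \<le> emeasure \<mu> (cball 0 \<sigma>)\<rbrakk> \<Longrightarrow>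
      T \<le> ennreal (2 powr (D * M powr (1 - p) + 3) * \<sigma> powr \<theta>)"
proof -
  define C where "C = B * 2 powr (N / \<theta>) / c"
  have C: "C > 0" using B_pos c by (simp add: C_def)
  define \<delta> where "\<delta> = (p - 1) * gain * (1 + gain * C powr (p - 1)) powr (- 2 * p)"
  have "1 + gain * C powr (p - 1) > 0" using gain_pos by (intro add_pos_nonneg) auto
  then have \<delta>: "\<delta> > 0" using p gain_pos by (simp add: \<delta>_def)
  show thesis
  proof
    show "1 / \<delta> > 0" using \<delta> by simp
    fix \<mu> :: "'a measure" and T u \<sigma> M
    assume sol: "supersolution \<mu> T u" and \<mu>: "sets \<mu> = sets borel" and \<sigma>: "\<sigma> > 0"
      and M: "M > 0" "ennreal M \<le> emeasure \<mu> (cball 0 \<sigma>)"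
    \<comment> \<open>Just above the largest index that the recursion permits. At most
      M^(1-p)/\<delta> + 2, it leads to the time 2^(n+1) \<sigma>^\<theta> and hence to the 3 in the
      exponent.\<close>
    define n where "n = nat \<lfloor>M powr (1 - p) / \<delta>\<rfloor> + 2"
    have n: "real n > M powr (1 - p) / \<delta> + 1" "real n \<le> M powr (1 - p) / \<delta> + 2"
      using \<delta> unfolding n_def by (auto simp: of_nat_nat) linarith+
    define \<tau> where "\<tau> k = 2 ^ k * \<sigma> powr \<theta>" for k :: nat
    have "\<not> ennreal (\<tau> (Suc n)) \<le> T"
    proof
      assume T: "ennreal (\<tau> (Suc n)) \<le> T"
      have "delayed_seq p gain M k \<le> C" if "k \<le> n" for k
      proof (rule ccontr)
        assume less: "\<not> delayed_seq p gain M k \<le> C"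
        have "\<tau> (Suc k) \<le> \<tau> (Suc n)"
          using that unfolding \<tau>_def by (intro mult_right_mono power_increasing) auto
        then have Tk: "ennreal (\<tau> (Suc k)) \<le> T" using T by (meson ennreal_leI order_trans)
        have tk: "\<tau> k > 0" using \<sigma> by (simp add: \<tau>_def)
        define R where "R = \<tau> k powr (1 / \<theta>)"
        \<comment> \<open>Since \<theta>/(p-1) = N, the threshold decays like the kernel; hence
          \<open>C\<close> is the same for all \<open>k\<close>.\<close>
        have R: "R > 0" "R powr \<theta> = \<tau> k" "R powr (- \<theta> / (p - 1)) = \<tau> k powr (- N / \<theta>)"
          using tk \<theta> crit by (auto simp: R_def powr_powr)
        have ab: "above u (c * \<tau> (Suc k) powr (- N / \<theta>) * delayed_seq p gain M k) R (\<tau> k) (\<tau> (Suc k))"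
          unfolding R_def \<tau>_def
          by (rule above_dyadic[OF crit sol \<mu> \<sigma>]) (use M Tk in \<open>auto simp: \<tau>_def\<close>)
        have "B * R powr (- \<theta> / (p - 1)) \<le> c * \<tau> (Suc k) powr (- N / \<theta>) * delayed_seq p gain M k"
        proof -
          have "\<tau> (Suc k) powr (- N / \<theta>) = 2 powr (- N / \<theta>) * \<tau> k powr (- N / \<theta>)"
            using tk by (simp add: \<tau>_def powr_mult[symmetric] mult_ac)
          moreover have "B \<le> c * 2 powr (- N / \<theta>) * delayed_seq p gain M k"
            using less c by (simp add: C_def powr_minus field_simps)
          then have "B * \<tau> k powr (- N / \<theta>) \<le> (c * 2 powr (- N / \<theta>) * delayed_seq p gain M k) * \<tau> k powr (- N / \<theta>)"
            by (intro mult_right_mono) auto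
          ultimately show ?thesis unfolding R(3) by (simp add: mult_ac)
        qed
        with ab have "above u (B * R powr (- \<theta> / (p - 1))) R (\<tau> k) (\<tau> k + R powr \<theta>)"
          using R by (elim above_mono) (auto simp: \<tau>_def)
        from not_above_large[OF sol R(1) _ _ this] show False
          using tk R(2) Tk by (simp_all add: \<tau>_def mult_ac)
      qed
      then have "real n * \<delta> \<le> M powr (1 - p) + \<delta>"
        unfolding \<delta>_def
        by (intro delayed_recursion_bound[where m = "delayed_seq p gain M"]) (use p gain_pos M C in auto)
      then show False using n(1) \<delta> by (simp add: field_simps)
    qed
    then have "T \<le> ennreal (\<tau> (Suc n))" by simp
    also have "\<tau> (Suc n) \<le> 2 powr (1 / \<delta> * M powr (1 - p) + 3) * \<sigma> powr \<theta>"
    proof -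
      have "(2::real) ^ Suc n = 2 powr real (Suc n)" by (simp only: powr_realpow)
      also have "\<dots> \<le> 2 powr (1 / \<delta> * M powr (1 - p) + 3)" using n(2) by (intro powr_mono) auto
      finally show ?thesis unfolding \<tau>_def by (intro mult_right_mono) auto
    qed
    then have "ennreal (\<tau> (Suc n)) \<le> ennreal (2 powr (1 / \<delta> * M powr (1 - p) + 3) * \<sigma> powr \<theta>)"
      by (rule ennreal_leI)
    finally show "T \<le> ennreal (2 powr (1 / \<delta> * M powr (1 - p) + 3) * \<sigma> powr \<theta>)" .
  qed
qed

end

subsection \<open>Slowly decaying initial data\<close>

text \<open>The minorant of the data for lambda = 1, with a Borel density;
  \<open>function_measure_ge_decay\<close> transfers its mass to the actual data.\<close>

definition decay_measure :: "real \<Rightarrow> 'a::euclidean_space measure" where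
  "decay_measure A = density lborel (\<lambda>x. ennreal ((1 + norm x) powr (- A)))"

lemma sets_decay_measure [simp]: "sets (decay_measure A) = sets borel"
  by (simp add: decay_measure_def)

lemma decay_measure_lower:
  fixes E :: "'a::euclidean_space set"
  assumes [measurable]: "E \<in> sets borel" and E: "E \<subseteq> cball 0 R" and A: "A \<ge> 0"
  shows "ennreal ((1 + R) powr (- A)) * emeasure lborel E \<le> emeasure (decay_measure A) E"
proof -
  have "ennreal ((1 + R) powr (- A)) * emeasure lborel E =
      (\<integral>\<^sup>+ x. ennreal ((1 + R) powr (- A)) * indicator E x \<partial>lborel)"
    by (subst nn_integral_cmult_indicator) auto
  also have "\<dots> \<le> (\<integral>\<^sup>+ x. ennreal ((1 + norm x) powr (- A)) * indicator E x \<partial>lborel)"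
  proof (rule nn_integral_mono)
    fix x :: 'a
    have "(1 + R) powr (- A) \<le> (1 + norm x) powr (- A)" if "x \<in> E"
      using that E A by (intro powr_mono2') (auto simp: add_pos_nonneg)
    then show "ennreal ((1 + R) powr (- A)) * indicator E x \<le> ennreal ((1 + norm x) powr (- A)) * indicator E x"
      by (auto simp: indicator_def intro!: ennreal_leI)
  qed
  also have "\<dots> = emeasure (decay_measure A) E"
    unfolding decay_measure_def by (subst emeasure_density) auto
  finally show ?thesis .
qed

text \<open>For \<open>A < N\<close> the density on the ball is at least (2R)^(-A), which is
  multiplied by the volume. For \<open>A \<ge> N\<close> the unit ball already carries the stated
  constant mass.\<close>

lemma decay_measure_cball:
  fixes A R :: real
  defines "N \<equiv> real DIM('a::euclidean_space)"
  assumes A: "A \<ge> 0" and R: "R \<ge> 1"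
  shows "ennreal (2 powr (- A) * unit_ball_vol N * R powr (N - min A N))
    \<le> emeasure (decay_measure A) (cball (0::'a) R)"
proof (cases "A < N")
  case True
  have "ennreal ((1 + R) powr (- A)) * emeasure lborel (cball (0::'a) R) \<le> emeasure (decay_measure A) (cball (0::'a) R)"
    using A by (intro decay_measure_lower) auto
  moreover have "2 powr (- A) * unit_ball_vol N * R powr (N - A) \<le> (1 + R) powr (- A) * (unit_ball_vol N * R ^ DIM('a))"
  proof -
    have "(2 * R) powr (- A) \<le> (1 + R) powr (- A)" using A R by (intro powr_mono2') auto
    then have "2 powr (- A) * R powr (- A) * (unit_ball_vol N * R powr N) \<le> (1 + R) powr (- A) * (unit_ball_vol N * R powr N)"
      by (intro mult_right_mono) (auto simp: powr_mult N_def)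
    then show ?thesis using R by (simp add: powr_diff powr_minus N_def powr_realpow field_simps)
  qed
  then have "ennreal (2 powr (- A) * unit_ball_vol N * R powr (N - A)) \<le>
      ennreal ((1 + R) powr (- A)) * emeasure lborel (cball (0::'a) R)"
    using R by (simp only: emeasure_cball N_def[symmetric] ennreal_mult'[symmetric] powr_ge_zero ennreal_leI)
  ultimately show ?thesis using True by simp
next
  case False
  have "ennreal (2 powr (- A) * unit_ball_vol N) = ennreal ((1 + 1) powr (- A)) * emeasure lborel (cball (0::'a) 1)"
    by (simp add: emeasure_cball N_def ennreal_mult')
  also have "\<dots> \<le> emeasure (decay_measure A) (cball (0::'a) 1)"
    using A by (intro decay_measure_lower) auto
  also have "\<dots> \<le> emeasure (decay_measure A) (cball (0::'a) R)"
    using R by (intro emeasure_mono) auto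
  finally show ?thesis using False R by simp
qed

text \<open>At the borderline decay every dyadic shell carries at least the same mass
  \<open>k\<close>, and about log R shells fit into the ball.\<close>

lemma decay_measure_cball_log:
  fixes R :: real
  defines "N \<equiv> real DIM('a::euclidean_space)"
  assumes R: "R \<ge> 2"
  shows "ennreal (unit_ball_vol N * 4 powr (- N) / 2 * ln R) \<le> emeasure (decay_measure N) (cball (0::'a) R)"
proof -
  have N: "N \<ge> 1" by (simp add: N_def Suc_leI)
  define k where "k = unit_ball_vol N * 4 powr (- N)"
  have k: "k > 0" by (simp add: k_def N_def)
  have dyadic: "ennreal (k * real n) \<le> emeasure (decay_measure N) (cball (0::'a) (2 ^ n))" for n
  proof (induction n)
    case (Suc n)
    let ?E = "cball (0::'a) (2 ^ Suc n) - cball 0 (2 ^ n)"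
    have sub: "cball (0::'a) (2 ^ n) \<subseteq> cball 0 (2 ^ Suc n)" by (rule subset_cball) simp
    have vol: "emeasure lborel ?E = ennreal (unit_ball_vol N * ((2 ^ Suc n) powr N - (2 ^ n) powr N))"
      by (subst emeasure_Diff[OF _ _ _ sub])
        (auto simp: emeasure_cball N_def powr_realpow ennreal_minus right_diff_distrib)
    have "k \<le> (1 + 2 ^ Suc n) powr (- N) * (unit_ball_vol N * ((2 ^ Suc n) powr N - (2 ^ n) powr N))"
    proof -
      have "(4 * 2 ^ n) powr (- N) \<le> (1 + 2 ^ Suc n :: real) powr (- N)"
      proof (rule powr_mono2')
        have "(1::real) \<le> 2 ^ n" by simp
        then show "(1 + 2 ^ Suc n :: real) \<le> 4 * 2 ^ n" unfolding power_Suc by linarith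
      qed (use N in \<open>auto simp: add_pos_nonneg\<close>)
      moreover have "(2 ^ n) powr N \<le> (2 ^ Suc n) powr N - (2 ^ n :: real) powr N"
      proof -
        \<comment> \<open>As N is at least 1, a shell has at least the volume of the ball inside
          it.\<close>
        have "(2::real) powr 1 \<le> 2 powr N" using N by (intro powr_mono) auto
        then have "2 * (2 ^ n :: real) powr N \<le> 2 powr N * (2 ^ n) powr N" by (intro mult_right_mono) auto
        then show ?thesis by (simp add: powr_mult)
      qed
      ultimately have "(4 * 2 ^ n) powr (- N) * (unit_ball_vol N * (2 ^ n) powr N) \<le>
          (1 + 2 ^ Suc n) powr (- N) * (unit_ball_vol N * ((2 ^ Suc n) powr N - (2 ^ n :: real) powr N))"
        by (intro mult_mono) (auto simp: N_def)
      moreover have "(4 * 2 ^ n :: real) powr (- N) * (unit_ball_vol N * (2 ^ n) powr N) = k"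
        by (simp add: k_def powr_mult powr_minus field_simps)
      ultimately show ?thesis by simp
    qed
    then have "ennreal k \<le> ennreal ((1 + 2 ^ Suc n) powr (- N)) * emeasure lborel ?E"
      unfolding vol by (simp add: ennreal_mult'[symmetric] ennreal_leI)
    also have "\<dots> \<le> emeasure (decay_measure N) ?E"
      using N by (intro decay_measure_lower) auto
    finally have "ennreal (k * real n) + ennreal k \<le>
        emeasure (decay_measure N) (cball (0::'a) (2 ^ n)) + emeasure (decay_measure N) ?E"
      using Suc.IH by (rule add_mono[rotated])
    also have "\<dots> = emeasure (decay_measure N) (cball (0::'a) (2 ^ n) \<union> ?E)"
      by (rule plus_emeasure) auto
    also have "cball (0::'a) (2 ^ n) \<union> ?E = cball 0 (2 ^ Suc n)"
      using sub by blast
    finally show ?case using k by (simp add: ennreal_plus[symmetric] algebra_simps del: ennreal_plus)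
  qed simp
  define n where "n = nat \<lfloor>log 2 R\<rfloor>"
  have lg: "log 2 R \<ge> 1" using R by (simp add: le_log_iff)
  then have n: "real n \<le> log 2 R" "real n > log 2 R - 1"
    unfolding n_def by linarith+
  have "n \<ge> 1" using lg by (simp add: n_def le_nat_floor)
  have "(2::real) ^ n = 2 powr real n" by (simp add: powr_realpow)
  also have "\<dots> \<le> R" using n R by (simp add: le_log_iff)
  finally have R2: "2 ^ n \<le> R" .
  have "ln R \<le> log 2 R"
    using R ln_2_less_1 by (simp add: log_def le_divide_eq mult_left_le)
  \<comment> \<open>Rounding down costs at most a factor 2, because \<open>n\<close> is at least
    1.\<close>
  then have "ln R / 2 \<le> real n" using n \<open>n \<ge> 1\<close> by linarith
  then have "unit_ball_vol N * 4 powr (- N) / 2 * ln R \<le> k * real n"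
    using mult_left_mono[of "ln R / 2" "real n" k] k by (simp add: k_def)
  then have "ennreal (unit_ball_vol N * 4 powr (- N) / 2 * ln R) \<le> ennreal (k * real n)"
    by (rule ennreal_leI)
  also note dyadic
  also have "emeasure (decay_measure N) (cball (0::'a) (2 ^ n)) \<le> emeasure (decay_measure N) (cball (0::'a) R)"
    using R2 by (intro emeasure_mono) auto
  finally show ?thesis .
qed

lemma sets_function_measure [simp]: "sets (function_measure f) = sets borel"
  by (simp add: function_measure_def)

lemma function_measure_ge_decay:
  fixes \<phi> :: "'a::euclidean_space \<Rightarrow> real"
  assumes [measurable]: "\<phi> \<in> borel_measurable lebesgue" and E: "E \<in> sets borel" and lam: "lam \<ge> 0"
    and lower: "AE x in lebesgue. (1 + norm x) powr (- A) \<le> \<phi> x"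
  shows "ennreal lam * emeasure (decay_measure A) E \<le> emeasure (function_measure (\<lambda>x. lam * \<phi> x)) E"
proof -
  have [measurable]: "E \<in> sets lebesgue" using E by (simp add: sets_completionI_sets)
  have id: "(\<lambda>x. x) \<in> density lebesgue (\<lambda>x. ennreal (lam * \<phi> x)) \<rightarrow>\<^sub>M borel"
    by (simp add: measurable_completion)
  have "ennreal lam * emeasure (decay_measure A) E =
      (\<integral>\<^sup>+ x. ennreal lam * (ennreal ((1 + norm x) powr (- A)) * indicator E x) \<partial>lborel)"
    unfolding decay_measure_def using E by (subst nn_integral_cmult) (auto simp: emeasure_density)
  also have "\<dots> \<le> (\<integral>\<^sup>+ x. ennreal (lam * \<phi> x) * indicator E x \<partial>lborel)"
  proof (rule nn_integral_mono_AE, rule eventually_mono[OF lower[unfolded AE_completion_iff]])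
    fix x assume "(1 + norm x) powr (- A) \<le> \<phi> x"
    then have "ennreal (lam * (1 + norm x) powr (- A)) \<le> ennreal (lam * \<phi> x)"
      using lam by (intro ennreal_leI mult_left_mono)
    then show "ennreal lam * (ennreal ((1 + norm x) powr (- A)) * indicator E x) \<le> ennreal (lam * \<phi> x) * indicator E x"
      using lam by (auto simp: indicator_def ennreal_mult)
  qed
  also have "\<dots> = emeasure (density lebesgue (\<lambda>x. ennreal (lam * \<phi> x))) E"
    by (subst emeasure_density) (auto simp: nn_integral_completion)
  also have "\<dots> = emeasure (function_measure (\<lambda>x. lam * \<phi> x)) E"
    unfolding function_measure_def using E id by (subst emeasure_distr) auto
  finally show ?thesis .
qed

section \<open>From bounds for every solution to bounds for the maximal time\<close>

lemma log_leI:
  assumes "T \<le> ennreal (exp b)"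
  shows "log_le T b"
proof -
  have "T < \<infinity>" using assms le_less_trans by fastforce
  moreover have "ln (enn2real T) \<le> b" if "T \<noteq> 0"
  proof -
    have "enn2real T > 0" using that \<open>T < \<infinity>\<close> by (simp add: enn2real_positive_iff zero_less_iff_neq_zero)
    moreover have "enn2real T \<le> exp b" using assms by (simp add: enn2real_leI)
    ultimately show ?thesis using ln_le_cancel_iff[of "enn2real T" "exp b"] by simp
  qed
  ultimately show ?thesis by (auto simp: log_le_def)
qed

text \<open>Made for \<open>mass_bound\<close>, which at time \<open>t\<close> needs a solution up
  to \<open>2 * t\<close>. It is the source of the factor 2 in the constants of (ii).\<close>

lemma ennreal_le_if_doubles_le:
  assumes b: "b \<ge> 0" and *: "\<And>t. b < t \<Longrightarrow> ennreal (2 * t) \<le> T \<Longrightarrow> False"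
  shows "T \<le> ennreal (2 * b)"
proof (rule ccontr)
  assume "\<not> ?thesis"
  then obtain y where y: "ennreal (2 * b) < y" "y < T" using dense[of "ennreal (2 * b)" T] by (auto simp: not_le)
  then obtain r where r: "y = ennreal r" "r \<ge> 0" by (cases y) auto
  have "2 * b < r" using y(1) r b by (simp add: ennreal_less_iff)
  then show False using *[of "r / 2"] y(2) r by (simp add: less_imp_le)
qed

text \<open>A minimal solution is in particular a solution, so bounding the lifespan of every
  solution suffices.\<close>

lemma maximal_time_leI:
  assumes "\<And>T' u. cauchy_solution G p \<mu> T' u \<Longrightarrow> T' \<le> b"
  shows "maximal_time G p \<mu> \<le> b"
  unfolding maximal_time_def by (rule Sup_least) (use assms in \<open>auto simp: minimal_solution_def\<close>)

text \<open>Inverts t^\<alpha> ln t = E L up to constants. At t = Q (L / ln L)^(1/\<alpha>) the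
  power t^\<alpha> is at least sqrt L, so ln t is at least ln L / (2\<alpha>), and the two
  occurrences of ln L cancel in the product.\<close>

lemma powr_mult_ln_bound:
  fixes \<alpha> E L Q t :: real
  assumes \<alpha>: "\<alpha> > 0" and L: "L > exp 1" and Q: "Q powr \<alpha> \<ge> 2" "Q powr \<alpha> \<ge> 2 * \<alpha> * E" "Q > 0"
    and t: "Q * (L / ln L) powr (1 / \<alpha>) < t"
  shows "E * L < t powr \<alpha> * ln t"
proof -
  have L1: "L > 0" using L exp_gt_zero[of 1] by linarith
  have ln: "ln L > 1" using L L1 ln_less_cancel_iff[of "exp 1" L] by simp
  define b where "b = Q * (L / ln L) powr (1 / \<alpha>)"
  have LL: "L / ln L > 0" by (rule divide_pos_pos[OF L1]) (use ln in linarith)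
  then have b: "b > 0" using Q(3) unfolding b_def by (intro mult_pos_pos) (auto simp only: powr_gt_zero)
  have "1 / \<alpha> * \<alpha> = 1" using \<alpha> by simp
  then have b\<alpha>: "b powr \<alpha> = Q powr \<alpha> * (L / ln L)"
    by (simp only: b_def powr_mult powr_powr powr_one[OF less_imp_le[OF LL]])
  have "ln L = 2 * ln (sqrt L)" using L1 by (simp add: ln_sqrt)
  also have "\<dots> \<le> 2 * sqrt L" using ln_le_minus_one[of "sqrt L"] L1 by simp
  finally have "sqrt L * ln L \<le> sqrt L * (2 * sqrt L)" using L1 by (intro mult_left_mono) auto
  moreover have "sqrt L * sqrt L = L" using L1 by simp
  ultimately have "sqrt L * ln L \<le> 2 * L"
    by (simp only: mult.left_commute)
  then have "sqrt L \<le> 2 * (L / ln L)" using ln by (simp add: field_simps)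
  also have "\<dots> \<le> b powr \<alpha>" unfolding b\<alpha> using Q LL by (intro mult_right_mono less_imp_le[OF LL])
  finally have sq: "sqrt L \<le> b powr \<alpha>" .
  have bt: "b powr \<alpha> < t powr \<alpha>" using t b \<alpha> by (intro powr_less_mono2) (auto simp: b_def)
  have "ln (sqrt L) < ln (t powr \<alpha>)" using sq bt L1 t b by (intro ln_less_cancel_iff[THEN iffD2]) (auto simp: b_def)
  then have lt: "ln L / (2 * \<alpha>) < ln t"
    using L1 \<alpha> t b by (simp add: ln_sqrt b_def ln_powr field_simps)
  have "E * L \<le> Q powr \<alpha> / (2 * \<alpha>) * L" using Q \<alpha> L1 by (intro mult_right_mono) (auto simp: field_simps)
  also have "\<dots> = b powr \<alpha> * (ln L / (2 * \<alpha>))" unfolding b\<alpha> using ln by simp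
  also have "\<dots> < t powr \<alpha> * ln t"
    using bt lt ln \<alpha> by (intro mult_strict_mono) (auto intro: powr_ge_zero)
  finally show ?thesis .
qed

theorem theorem5p2:
  fixes G :: "'a::euclidean_space \<Rightarrow> real \<Rightarrow> real"
    and \<phi> :: "'a \<Rightarrow> real"
    and \<theta> p A :: real
  defines "N \<equiv> real DIM('a)"
  defines "p\<^sub>\<theta> \<equiv> 1 + \<theta> / N"
  defines "T \<equiv> (\<lambda>lam::real. maximal_time G p (function_measure (\<lambda>x. lam * \<phi> x)))"
  assumes theta: "0 < \<theta>" "\<theta> \<le> 2"
    and p: "1 < p"
    and A: "0 < A"
    and G: "fundamental_solution \<theta> G"
    and phi_measurable: "\<phi> \<in> borel_measurable lebesgue"
    and phi_nonneg: "AE x in lebesgue. 0 \<le> \<phi> x"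
    and phi_bounded: "\<exists>M. AE x in lebesgue. \<bar>\<phi> x\<bar> \<le> M"
    and phi_lower: "AE x in lebesgue. (1 + norm x) powr (- A) \<le> \<phi> x"
  shows
    "(p = p\<^sub>\<theta> \<and> A \<ge> \<theta> / (p - 1) \<longrightarrow>
       (\<exists>C\<^sub>1>0. \<forall>\<^sub>F lam in at_right 0.
          log_le (T lam)
            (if A > N then C\<^sub>1 * lam powr (- (p - 1))
             else C\<^sub>1 * lam powr (- ((p - 1) / p))))) \<and>
     (p < p\<^sub>\<theta> \<or> A < \<theta> / (p - 1) \<longrightarrow>
       (\<exists>C\<^sub>2>0. \<forall>\<^sub>F lam in at_right 0.
          T lam \<le> ennreal
            (if A \<noteq> N then C\<^sub>2 * lam powr (- inverse (1 / (p - 1) - min A N / \<theta>))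
             else C\<^sub>2 * (inverse lam / ln (inverse lam)) powr inverse (1 / (p - 1) - N / \<theta>))))"
proof -
  obtain c where c: "c > 0" and Gc:
    "\<And>x t. \<lbrakk>t > 0; norm x \<le> 2 * 2 powr (1 / \<theta>) * t powr (1 / \<theta>)\<rbrakk> \<Longrightarrow> c * t powr (- real DIM('a) / \<theta>) \<le> G x t"
    using fundamental_solution_lower_bound[OF G theta(1)] by metis
  interpret kernel_lower G \<theta> p c N
    by unfold_locales (use N_def theta p c Gc in auto)
  define \<mu> where "\<mu> lam = function_measure (\<lambda>x. lam * \<phi> x)" for lam
  have sets_\<mu>: "sets (\<mu> lam) = sets borel" for lam by (simp add: \<mu>_def)
  have mass: "ennreal (lam * m) \<le> emeasure (\<mu> lam) (cball 0 R)"
    if "ennreal m \<le> emeasure (decay_measure A) (cball (0::'a) R)" "lam \<ge> 0" for lam m R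
  proof -
    have "ennreal (lam * m) = ennreal lam * ennreal m" using that(2) by (simp add: ennreal_mult')
    also have "\<dots> \<le> ennreal lam * emeasure (decay_measure A) (cball (0::'a) R)"
      using that(1) by (rule mult_left_mono) simp
    also have "\<dots> \<le> emeasure (\<mu> lam) (cball 0 R)"
      unfolding \<mu>_def using that(2) by (intro function_measure_ge_decay phi_measurable phi_lower) auto
    finally show ?thesis .
  qed
  define k where "k = 2 powr (- A) * \<omega>"
  define k' where "k' = \<omega> * 4 powr (- N) / 2"
  have k: "k > 0" "k' > 0" using \<omega>_pos by (simp_all add: k_def k'_def)
  have wt: "ennreal (k * R powr (N - min A N)) \<le> emeasure (decay_measure A) (cball (0::'a) R)" if "R \<ge> 1" for R
    using decay_measure_cball[where 'a = 'a, of A R] A that by (simp add: k_def N_def)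
  have wt_log: "ennreal (k' * ln R) \<le> emeasure (decay_measure A) (cball (0::'a) R)" if "R \<ge> 2" "A = N" for R
    using decay_measure_cball_log[where 'a = 'a, of R] that by (simp add: k'_def N_def)
  show ?thesis
  proof (intro conjI impI)
    assume "p = p\<^sub>\<theta> \<and> A \<ge> \<theta> / (p - 1)"
    then have crit: "p = 1 + \<theta> / N" and AN: "A \<ge> N" using theta by (auto simp: p\<^sub>\<theta>_def)
    obtain D where D: "D > 0" and T_bound:
      "\<And>\<mu> T u \<sigma> M. \<lbrakk>supersolution \<mu> T u; sets \<mu> = sets borel; \<sigma> > 0; M > 0; ennreal M \<le> emeasure \<mu> (cball 0 \<sigma>)\<rbrakk> \<Longrightarrow>
        T \<le> ennreal (2 powr (D * M powr (1 - p) + 3) * \<sigma> powr \<theta>)"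
      using critical_bound[OF crit] by metis
    have T_le: "T lam \<le> ennreal (exp (D * (lam * m) powr (1 - p) + 3 + \<theta> * ln \<sigma>))"
      if "lam > 0" "m > 0" "\<sigma> > 0" "ennreal m \<le> emeasure (decay_measure A) (cball (0::'a) \<sigma>)" for lam m \<sigma>
    proof -
      have "T lam \<le> ennreal (2 powr (D * (lam * m) powr (1 - p) + 3) * \<sigma> powr \<theta>)"
        unfolding T_def \<mu>_def[symmetric]
      proof (rule maximal_time_leI)
        fix T' u assume "cauchy_solution G p (\<mu> lam) T' u"
        then show "T' \<le> ennreal (2 powr (D * (lam * m) powr (1 - p) + 3) * \<sigma> powr \<theta>)"
          by (rule T_bound[OF cauchy_solution_supersolution sets_\<mu>]) (use that mass in auto)
      qed
      also have "\<dots> \<le> ennreal (exp (D * (lam * m) powr (1 - p) + 3 + \<theta> * ln \<sigma>))"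
      proof (rule ennreal_leI)
        let ?x = "D * (lam * m) powr (1 - p) + 3"
        have "?x \<ge> 0" using D by (intro add_nonneg_nonneg) auto
        then have "2 powr ?x \<le> exp ?x" using ln_2_less_1 by (simp add: powr_def mult_left_le)
        then have "2 powr ?x * \<sigma> powr \<theta> \<le> exp ?x * \<sigma> powr \<theta>" by (intro mult_right_mono) auto
        also have "\<dots> = exp (?x + \<theta> * ln \<sigma>)" using that(3) by (simp add: powr_def exp_add)
        finally show "2 powr ?x * \<sigma> powr \<theta> \<le> exp (?x + \<theta> * ln \<sigma>)" .
      qed
      finally show ?thesis .
    qed
    have small: "\<forall>\<^sub>F lam::real in at_right 0. lam \<in> {0<..<1}"
      by (rule eventually_at_right_real) simp
    show "\<exists>C\<^sub>1>0. \<forall>\<^sub>F lam in at_right 0. log_le (T lam)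
            (if A > N then C\<^sub>1 * lam powr (- (p - 1)) else C\<^sub>1 * lam powr (- ((p - 1) / p)))"
    proof (cases "A > N")
      case True
      \<comment> \<open>The unit ball suffices here: its radius contributes \<open>ln 1 = 0\<close>,
        and the 3 is absorbed because the power of \<open>lam\<close> is at least 1.\<close>
      define C where "C = D * k powr (1 - p) + 3"
      have "C > 0" using D by (simp add: C_def add_nonneg_pos)
      moreover have "\<forall>\<^sub>F lam in at_right 0. log_le (T lam) (C * lam powr (- (p - 1)))"
      proof (rule eventually_mono[OF small], rule log_leI)
        fix lam :: real assume lam: "lam \<in> {0<..<1}"
        have "1 \<le> lam powr (- (p - 1))" using lam p powr_mono'[of "- (p - 1)" 0 lam] by simp
        then have "D * (lam * k) powr (1 - p) + 3 + \<theta> * ln 1 \<le> C * lam powr (- (p - 1))"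
          using lam k by (simp add: C_def powr_mult algebra_simps)
        moreover have "T lam \<le> ennreal (exp (D * (lam * k) powr (1 - p) + 3 + \<theta> * ln 1))"
          using lam k wt[of 1] True by (intro T_le) auto
        ultimately show "T lam \<le> ennreal (exp (C * lam powr (- (p - 1))))"
          by (meson ennreal_leI exp_le_cancel_iff order_trans)
      qed
      ultimately show ?thesis using True by auto
    next
      case False
      then have AN: "A = N" using AN by simp
      define C where "C = D * k' powr (1 - p) + 3 + \<theta>"
      have "C > 0" using D theta by (auto simp: C_def intro!: add_nonneg_pos)
      moreover have "\<forall>\<^sub>F lam in at_right 0. log_le (T lam) (C * lam powr (- ((p - 1) / p)))"
      proof (rule eventually_mono[OF small], rule log_leI)
        fix lam :: real assume lam: "lam \<in> {0<..<1}"
        (* The radius exp L balances the two summands of the exponent in T_le. *)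
        define L where "L = lam powr (- ((p - 1) / p))"
        have L: "1 \<le> L" using lam p powr_mono'[of "- ((p - 1) / p)" 0 lam] by (simp add: L_def)
        have "2 \<le> exp L" using exp_ge_add_one_self[of L] L by linarith
        \<comment> \<open>\<open>L\<close> solves (lam L)^(1-p) = L, which is the origin of the
          exponent (p-1)/p.\<close>
        have "lam * L = lam powr (1 / p)"
        proof -
          have "1 + - ((p - 1) / p) = 1 / p" using p by (simp add: field_simps)
          then show ?thesis using lam powr_add[of lam 1 "- ((p - 1) / p)"] by (simp add: L_def)
        qed
        then have "(lam * (k' * L)) powr (1 - p) = k' powr (1 - p) * (lam powr (1 / p)) powr (1 - p)"
          using k lam by (simp add: powr_mult mult.left_commute)
        also have "(lam powr (1 / p)) powr (1 - p) = L"
          unfolding L_def powr_powr by (rule arg_cong[of _ _ "\<lambda>e. lam powr e"]) (use p in \<open>simp add: field_simps\<close>)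
        finally have M: "(lam * (k' * L)) powr (1 - p) = k' powr (1 - p) * L" .
        have "D * (lam * (k' * L)) powr (1 - p) + 3 + \<theta> * ln (exp L) \<le> C * L"
          unfolding M using L by (simp add: C_def algebra_simps)
        moreover have "T lam \<le> ennreal (exp (D * (lam * (k' * L)) powr (1 - p) + 3 + \<theta> * ln (exp L)))"
          using lam k L wt_log[OF \<open>2 \<le> exp L\<close> AN] by (intro T_le) auto
        ultimately show "T lam \<le> ennreal (exp (C * lam powr (- ((p - 1) / p))))"
          unfolding L_def by (meson ennreal_leI exp_le_cancel_iff order_trans)
      qed
      ultimately show ?thesis using False by auto
    qed
  next
    assume sub: "p < p\<^sub>\<theta> \<or> A < \<theta> / (p - 1)"
    define \<alpha> where "\<alpha> = 1 / (p - 1) - min A N / \<theta>"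
    have \<alpha>: "\<alpha> > 0"
    proof -
      \<comment> \<open>Each alternative of the hypothesis bounds one of the two arguments of
        \<open>min\<close>.\<close>
      have "min A N < \<theta> / (p - 1)"
      proof (cases "A < \<theta> / (p - 1)")
        case False
        then have "p - 1 < \<theta> / N" using sub by (simp add: p\<^sub>\<theta>_def)
        then have "N < \<theta> / (p - 1)" using p N_pos by (simp add: field_simps)
        then show ?thesis by simp
      qed auto
      then show ?thesis using theta p by (simp add: \<alpha>_def field_simps)
    qed
    define C where "C = B * 2 powr (N / \<theta>) / c"
    have C: "C > 0" using B_pos c by (simp add: C_def)
    have mass_le: "lam * m \<le> C * t powr (N / \<theta> - 1 / (p - 1))"
      if "cauchy_solution G p (\<mu> lam) T' u" "t > 0" "ennreal (2 * t) \<le> T'" "lam > 0" "m \<ge> 0"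
        "ennreal m \<le> emeasure (decay_measure A) (cball (0::'a) (t powr (1 / \<theta>)))" for lam T' u t m
      unfolding C_def using that
      by (intro mass_bound[OF cauchy_solution_supersolution[OF that(1)] sets_\<mu>] mass) auto
    show "\<exists>C\<^sub>2>0. \<forall>\<^sub>F lam in at_right 0. T lam \<le> ennreal
            (if A \<noteq> N then C\<^sub>2 * lam powr (- inverse (1 / (p - 1) - min A N / \<theta>))
             else C\<^sub>2 * (inverse lam / ln (inverse lam)) powr inverse (1 / (p - 1) - N / \<theta>))"
    proof (cases "A = N")
      case False
      \<comment> \<open>The second entry comes from solving k lam t^\<alpha> \<le> C for t; the 1
        ensures t > 1, so that the ball of radius t^(1/\<theta>) is admissible in
        \<open>wt\<close>.\<close>
      define Q where "Q = max 1 ((C / k) powr (1 / \<alpha>))"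
      have "\<forall>\<^sub>F lam in at_right 0. T lam \<le> ennreal (2 * Q * lam powr (- inverse \<alpha>))"
      proof (rule eventually_mono[OF eventually_at_right_real[of 0 1]])
        fix lam :: real assume lam: "lam \<in> {0<..<1}"
        define b where "b = Q * lam powr (- inverse \<alpha>)"
        have "1 \<le> lam powr (- inverse \<alpha>)" using lam \<alpha> powr_mono'[of "- inverse \<alpha>" 0 lam] by simp
        then have b1: "1 \<le> b" using mult_mono[of 1 Q 1 "lam powr (- inverse \<alpha>)"] by (simp add: b_def Q_def)
        have "T' \<le> ennreal (2 * b)" if sol: "cauchy_solution G p (\<mu> lam) T' u" for T' u
        proof (rule ennreal_le_if_doubles_le)
          fix t assume t: "b < t" "ennreal (2 * t) \<le> T'"
          have t1: "t > 1" using t b1 by simp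
          have "t powr (1 / \<theta>) \<ge> 1" using t1 theta by (intro ge_one_powr_ge_zero) auto
          then have "lam * (k * (t powr (1 / \<theta>)) powr (N - min A N)) \<le> C * t powr (N / \<theta> - 1 / (p - 1))"
            using t t1 lam k by (intro mass_le[OF sol] wt) auto
          \<comment> \<open>The first factor also stands on the right-hand side and cancels; the
            exponent that is left is \<alpha>.\<close>
          also have "(t powr (1 / \<theta>)) powr (N - min A N) = t powr (N / \<theta> - 1 / (p - 1)) * t powr \<alpha>"
            by (simp add: powr_powr \<alpha>_def diff_divide_distrib flip: powr_add)
          finally have "t powr \<alpha> \<le> C / k / lam"
            using t1 lam k by (simp add: field_simps)
          then have "(t powr \<alpha>) powr (1 / \<alpha>) \<le> (C / k / lam) powr (1 / \<alpha>)"
            using \<alpha> by (intro powr_mono2) auto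
          also have "\<dots> = (C / k) powr (1 / \<alpha>) * lam powr (- inverse \<alpha>)"
            using powr_divide[of "C / k" lam] lam k C by (simp add: powr_minus divide_inverse)
          also have "\<dots> \<le> b" unfolding b_def Q_def by (intro mult_right_mono) auto
          finally show False using t t1 \<alpha> by (simp add: powr_powr)
        qed (use b1 in simp)
        then have "T lam \<le> ennreal (2 * b)" unfolding T_def \<mu>_def by (rule maximal_time_leI)
        then show "T lam \<le> ennreal (2 * Q * lam powr (- inverse \<alpha>))" by (simp add: b_def mult.assoc)
      qed simp
      moreover have "2 * Q > 0" by (simp add: Q_def less_max_iff_disj)
      ultimately show ?thesis using False unfolding \<alpha>_def[symmetric] by (intro exI[of _ "2 * Q"]) simp
    next
      case True
      \<comment> \<open>\<open>E\<close> collects the constants when lam k' ln t / \<theta> \<le> C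
        t^(-\<alpha>) is solved for t^\<alpha> ln t.\<close>
      define E where "E = C * \<theta> / k'"
      \<comment> \<open>The first entry makes the radius t^(1/\<theta>) at least 2, as
        \<open>wt_log\<close> requires; the second supplies both size conditions of
        \<open>powr_mult_ln_bound\<close>.\<close>
      define Q where "Q = max (2 powr \<theta>) ((max 2 (2 * \<alpha> * E)) powr (1 / \<alpha>))"
      have \<alpha>N: "\<alpha> = 1 / (p - 1) - N / \<theta>" using True by (simp add: \<alpha>_def)
      have Q0: "Q > 0" by (simp add: Q_def less_max_iff_disj)
      have "(max 2 (2 * \<alpha> * E) powr (1 / \<alpha>)) powr \<alpha> \<le> Q powr \<alpha>"
        using \<alpha> by (intro powr_mono2) (auto simp: Q_def)
      then have Q: "Q powr \<alpha> \<ge> 2" "Q powr \<alpha> \<ge> 2 * \<alpha> * E" using \<alpha> by (auto simp: powr_powr)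
      have "\<forall>\<^sub>F lam in at_right 0. T lam \<le> ennreal (2 * Q * (inverse lam / ln (inverse lam)) powr inverse \<alpha>)"
      \<comment> \<open>Below 1/e the logarithm of the inverse exceeds 1, so the quotient is defined
        and at least 1.\<close>
      proof (rule eventually_mono[OF eventually_at_right_real[of 0 "inverse (exp 1)"]])
        fix lam :: real assume lam: "lam \<in> {0<..<inverse (exp 1)}"
        define L where "L = inverse lam"
        have L: "L > exp 1" using lam less_imp_inverse_less[of lam "inverse (exp 1)"] by (simp add: L_def)
        have L1: "L > 0" using L exp_gt_zero[of 1] by linarith
        have lnL: "ln L > 1" using L L1 ln_less_cancel_iff[of "exp 1" L] by simp
        define b where "b = Q * (L / ln L) powr (1 / \<alpha>)"
        have "1 \<le> L / ln L" using ln_le_minus_one[OF L1] lnL by (simp add: le_divide_eq)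
        then have "1 \<le> (L / ln L) powr (1 / \<alpha>)" using \<alpha> by (intro ge_one_powr_ge_zero) auto
        then have b2: "2 powr \<theta> \<le> b"
          using mult_mono[of "2 powr \<theta>" Q 1 "(L / ln L) powr (1 / \<alpha>)"] Q0 by (simp add: b_def Q_def)
        have b0: "b > 0" by (rule less_le_trans[OF _ b2]) simp
        have "T' \<le> ennreal (2 * b)" if sol: "cauchy_solution G p (\<mu> lam) T' u" for T' u
        proof (rule ennreal_le_if_doubles_le)
          fix t assume t: "b < t" "ennreal (2 * t) \<le> T'"
          have t0: "t > 0" using t b0 by simp
          have "(2 powr \<theta>) powr (1 / \<theta>) \<le> t powr (1 / \<theta>)" using t b2 theta by (intro powr_mono2) auto
          then have R2: "2 \<le> t powr (1 / \<theta>)" using theta by (simp add: powr_powr)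
          have "0 \<le> k' * ln (t powr (1 / \<theta>))"
            using k R2 by (intro mult_nonneg_nonneg ln_ge_zero) auto
          then have "lam * (k' * ln (t powr (1 / \<theta>))) \<le> C * t powr (N / \<theta> - 1 / (p - 1))"
            using t t0 lam R2 by (intro mass_le[OF sol] wt_log True) (auto simp del: ln_powr)
          also have "N / \<theta> - 1 / (p - 1) = - \<alpha>" by (simp add: \<alpha>N)
          finally have "t powr \<alpha> * (lam * (k' * (ln t / \<theta>))) \<le> t powr \<alpha> * (C * t powr (- \<alpha>))"
            using t0 by (intro mult_left_mono) (auto simp: ln_powr)
          also have "\<dots> = C" using t0 by (simp add: powr_minus)
          finally have "t powr \<alpha> * ln t \<le> E * L"
            using lam k theta by (simp add: E_def L_def field_simps)
          moreover have "E * L < t powr \<alpha> * ln t"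
            using t by (intro powr_mult_ln_bound[OF \<alpha> L Q Q0]) (simp add: b_def)
          ultimately show False by simp
        qed (use b0 in simp)
        then have "T lam \<le> ennreal (2 * b)" unfolding T_def \<mu>_def by (rule maximal_time_leI)
        then show "T lam \<le> ennreal (2 * Q * (inverse lam / ln (inverse lam)) powr inverse \<alpha>)"
          by (simp add: b_def L_def mult.assoc inverse_eq_divide)
      qed simp
      then show ?thesis using True Q0 unfolding \<alpha>N by (intro exI[of _ "2 * Q"]) simp
    qed
  qed
qed

end
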